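(* Let $f$ be a transcendental meromorphic function on $\mathbb{C}$ of finite order, let $c\in\mathbb{C}$, and put $\Delta f(z)=f(z+c)-f(z)$, where $\Delta f\not\equiv 0$. Let $e_1,e_2\in\mathbb{C}$ be two distinct finite values. If $\Delta f$ and $f$ share the three distinct values $e_1$, $e_2$, $\infty$ CM, then $f=\Delta f$ identically, i.e. $f(z+c)=2f(z)$.
   Context: Meromorphic means meromorphic in the whole complex plane; transcendental means not a rational function. The order of $f$ is $\rho(f)=\limsup_{r\to\infty}\frac{\log^+ T(r,f)}{\log r}$, where $T(r,f)$ is the Nevanlinna characteristic function; $f$ is of finite order if $\rho(f)<\infty$. Two meromorphic functions $f$ and $g$ share a finite value $a\in\mathbb{C}$ CM (counting multiplicities) if $f-a$ and $g-a$ have the same zeros with the same multiplicities; they share $\infty$ CM if they have the same poles with the same multiplicities. *)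

theory Defs
  imports "HOL-Complex_Analysis.Complex_Analysis"
begin

text \<open>
  A meromorphic function in the plane is represented by its unique representative that is
  \<open>nicely_meromorphic_on UNIV\<close>: removable singularities are filled in and the value at every
  pole is \<open>0\<close>. Hence equality of meromorphic functions is equality of functions, but a point
  where such a function has value \<open>0\<close> may be a pole, so zeros have to be told apart from poles.
\<close>

text \<open>
  The pointwise difference need not be the nice representative: where \<open>z\<close> and \<open>z + c\<close> are both
  poles of \<open>f\<close> the principal parts may cancel. \<open>remove_sings\<close> restores it.
\<close>

definition fdiff :: "complex \<Rightarrow> (complex \<Rightarrow> complex) \<Rightarrow> complex \<Rightarrow> complex" where
  "fdiff c f = remove_sings (\<lambda>z. f (z + c) - f z)"

text \<open>The values at the zeros of \<open>q\<close> are determined by niceness.\<close>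

definition rational_fun :: "(complex \<Rightarrow> complex) \<Rightarrow> bool" where
  "rational_fun f \<longleftrightarrow>
     (\<exists>p q. q \<noteq> 0 \<and> (\<forall>z. poly q z \<noteq> 0 \<longrightarrow> f z = poly p z / poly q z))"

definition transcendental_meromorphic :: "(complex \<Rightarrow> complex) \<Rightarrow> bool" where
  "transcendental_meromorphic f \<longleftrightarrow> f nicely_meromorphic_on UNIV \<and> \<not> rational_fun f"

definition ln_plus :: "real \<Rightarrow> real" where
  "ln_plus x = (if x \<le> 1 then 0 else ln x)"

definition proximity :: "(complex \<Rightarrow> complex) \<Rightarrow> real \<Rightarrow> real" where
  "proximity f r =
     1 / (2 * pi) * integral {0..2 * pi} (\<lambda>t. ln_plus (cmod (f (complex_of_real r * cis t))))"

definition pole_count :: "(complex \<Rightarrow> complex) \<Rightarrow> real \<Rightarrow> real" where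
  "pole_count f r = (\<Sum>z\<in>{z. cmod z \<le> r \<and> is_pole f z}. real_of_int (- zorder f z))"

definition integrated_pole_count :: "(complex \<Rightarrow> complex) \<Rightarrow> real \<Rightarrow> real" where
  "integrated_pole_count f r =
     integral {0..r} (\<lambda>t. (pole_count f t - pole_count f 0) / t) + pole_count f 0 * ln r"

definition nevanlinna_char :: "(complex \<Rightarrow> complex) \<Rightarrow> real \<Rightarrow> real" where
  "nevanlinna_char f r = proximity f r + integrated_pole_count f r"

definition growth_order :: "(complex \<Rightarrow> complex) \<Rightarrow> ereal" where
  "growth_order f = Limsup at_top (\<lambda>r. ereal (ln_plus (nevanlinna_char f r) / ln r))"

definition value_points :: "(complex \<Rightarrow> complex) \<Rightarrow> complex \<Rightarrow> complex set" where
  "value_points f a = {z. \<not> is_pole f z \<and> f z = a}"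

text \<open>
  \<open>zorder\<close> is unspecified for the zero function. This is harmless here: if exactly one of
  \<open>f\<close>, \<open>g\<close> is constantly \<open>a\<close>, the sets of \<open>a\<close>-points already differ.
\<close>

definition share_CM :: "(complex \<Rightarrow> complex) \<Rightarrow> (complex \<Rightarrow> complex) \<Rightarrow> complex \<Rightarrow> bool" where
  "share_CM f g a \<longleftrightarrow>
     value_points f a = value_points g a \<and>
     (\<forall>z\<in>value_points f a. zorder (\<lambda>w. f w - a) z = zorder (\<lambda>w. g w - a) z)"

definition share_infinity_CM :: "(complex \<Rightarrow> complex) \<Rightarrow> (complex \<Rightarrow> complex) \<Rightarrow> bool" where
  "share_infinity_CM f g \<longleftrightarrow>
     {z. is_pole f z} = {z. is_pole g z} \<and>
     (\<forall>z. is_pole f z \<longrightarrow> zorder f z = zorder g z)"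

end

theory Submission
  imports Defs
begin

text \<open>
  Write \<open>g\<close> for the difference of \<open>f\<close> and \<open>d = e2 - e1\<close>. Because the values \<open>e1\<close>, \<open>e2\<close> and \<open>\<infinity>\<close> are
  shared with multiplicities, \<open>(g - e1) / (f - e1)\<close> and \<open>(g - e2) / (f - e2)\<close> are entire without
  zeros, say \<open>exp P\<close> and \<open>exp Q\<close>. Finite order forces \<open>P\<close> and \<open>Q\<close> to be polynomials
  (\<open>shared_value_ratio_exp_polynomial\<close>). If \<open>exp P\<close> or \<open>exp Q\<close> is constantly \<open>1\<close>, then \<open>g = f\<close>; the
  same happens if \<open>exp P = exp Q\<close>, since eliminating \<open>f\<close> and \<open>g\<close> then leaves \<open>d * (exp P - 1) = 0\<close>.
  Otherwise \<open>f\<close> is the rational expression \<open>(d + e1 exp P - e2 exp Q) / (exp P - exp Q)\<close> in the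
  two exponentials. Substituting it, together with its shift by \<open>c\<close>, into
  \<open>f (z + c) = f z + g z\<close> gives a linear relation with constant coefficients between ten
  exponentials of polynomials in \<open>P\<close>, \<open>Q\<close> and their shifts (\<open>shared_exponentials_relation\<close>).

  The shift does not change leading coefficients. Let \<open>m\<close> be the larger degree and \<open>p\<close>, \<open>q\<close> the
  coefficients of \<open>z ^ m\<close> in \<open>P\<close>, \<open>Q\<close>. By Borel's independence of exponentials
  (\<open>exp_poly_independent\<close>) the terms of the relation with the same coefficient of \<open>z ^ m\<close> in the
  exponent already sum to \<open>0\<close>. The possible coefficients are \<open>p\<close>, \<open>q\<close>, \<open>2p\<close>, \<open>p + q\<close>, \<open>2q\<close>,
  \<open>2p + q\<close>, \<open>p + 2q\<close>, and in every configuration some of these groups are contradictory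
  (\<open>shifted_exponentials_no_relation\<close>). If \<open>m = 0\<close>, then \<open>f\<close> would be constant.

  The analytic half needs a growth bound for \<open>exp P\<close> and replaces the two main theorems of
  Nevanlinna theory by finite products in discs. In a disc of radius \<open>R\<close> a function of finite order
  is a quotient \<open>F / B\<close> of holomorphic functions with \<open>\<bar>B\<bar> \<le> 1\<close> and \<open>\<bar>F\<bar> \<le> exp (R ^ k)\<close>: \<open>B\<close> is the
  Blaschke product of the poles, and \<open>F\<close> is bounded by the Poisson integral of the positive part of
  \<open>ln \<bar>f\<bar>\<close> (\<open>bounded_quotient_on_disc\<close>). Hence \<open>exp P\<close> is, in that disc, a quotient \<open>A / D\<close> of
  bounded holomorphic functions, and \<open>D\<close> is not too small at one fixed point. Removing the zeros of
  \<open>D\<close> by Blaschke factors and applying the Harnack inequality to the zero-free rest bounds \<open>A / D\<close>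
  (\<open>quotient_bound\<close>). So the real part of \<open>P\<close> grows at most like a power, and \<open>P\<close> is a polynomial.
\<close>

section \<open>Linear independence of exponentials of polynomials\<close>

lemma pderiv_plus_mult_eq_0D:
  fixes A T :: "complex poly"
  assumes "pderiv A + A * T = 0" and "T \<noteq> 0"
  shows "A = 0"
proof (rule ccontr)
  assume "A \<noteq> 0"
  show False
  proof (cases "degree A = 0")
    case True
    then have "pderiv A = 0" by (simp add: pderiv_eq_0_iff)
    with assms \<open>A \<noteq> 0\<close> show False by simp
  next
    case False
    have "A * T = - pderiv A" using assms(1) by (simp add: add_eq_0_iff2)
    then have "degree (A * T) = degree (pderiv A)" by simp
    then show False
      using \<open>A \<noteq> 0\<close> \<open>T \<noteq> 0\<close> False by (simp add: degree_mult_eq degree_pderiv)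
  qed
qed

text \<open>
  Borel's argument. The operator \<open>F \<mapsto> F' - R1' F\<close> maps \<open>A exp R\<close> to
  \<open>(A' + A (R' - R1')) exp R\<close>. It lowers the degree of the coefficient of \<open>exp R1\<close>, so finitely many
  applications remove that term, and a nonzero coefficient of another exponential stays nonzero. Fixing the constant
  terms of the exponents as \<open>0\<close> makes distinct exponents differ by a nonconstant polynomial.
\<close>

lemma exp_poly_independent:
  fixes A :: "complex poly \<Rightarrow> complex poly"
  assumes "finite S" and "\<And>R. R \<in> S \<Longrightarrow> coeff R 0 = 0"
    and "\<And>z. (\<Sum>R\<in>S. poly (A R) z * exp (poly R z)) = 0"
  shows "\<forall>R\<in>S. A R = 0"
  using assms
proof (induction S arbitrary: A rule: finite_induct)
  case empty
  then show ?case by simp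
next
  case (insert R1 S)
  have claim: "\<forall>R\<in>insert R1 S. B R = 0"
    if "(pderiv ^^ n) (B R1) = 0"
      and "\<And>z. (\<Sum>R\<in>insert R1 S. poly (B R) z * exp (poly R z)) = 0" for n B
    using that
  proof (induction n arbitrary: B)
    case 0
    then have "\<And>z. (\<Sum>R\<in>S. poly (B R) z * exp (poly R z)) = 0"
      using insert.hyps by simp
    then have "\<forall>R\<in>S. B R = 0" using insert.IH[of B] insert.prems(1) by simp
    with 0 show ?case by simp
  next
    case (Suc n)
    \<comment> \<open>the coefficients of \<open>F' - R1' F\<close>\<close>
    define B' where "B' R = pderiv (B R) + B R * (pderiv R - pderiv R1)" for R
    have sum0: "(\<Sum>R\<in>insert R1 S. poly (B' R) z * exp (poly R z)) = 0" for z
    proof -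
      have "((\<lambda>w. \<Sum>R\<in>insert R1 S. poly (B R) w * exp (poly R w)) has_field_derivative
              (\<Sum>R\<in>insert R1 S. (poly (pderiv (B R) + B R * pderiv R) z) * exp (poly R z))) (at z)"
        by (intro DERIV_sum) (auto intro!: derivative_eq_intros poly_DERIV simp: algebra_simps)
      moreover have "(\<lambda>w. \<Sum>R\<in>insert R1 S. poly (B R) w * exp (poly R w)) = (\<lambda>w. 0)"
        using Suc.prems(2) by blast
      ultimately have "(\<Sum>R\<in>insert R1 S. (poly (pderiv (B R) + B R * pderiv R) z) * exp (poly R z)) = 0"
        using DERIV_unique[OF _ DERIV_const] by fastforce
      then have "(\<Sum>R\<in>insert R1 S. (poly (pderiv (B R) + B R * pderiv R) z) * exp (poly R z))
            - poly (pderiv R1) z * (\<Sum>R\<in>insert R1 S. poly (B R) z * exp (poly R z)) = 0"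
        using Suc.prems(2)[of z] by simp
      then show ?thesis
        unfolding sum_distrib_left sum_subtractf[symmetric] B'_def
        by (simp add: algebra_simps)
    qed
    have "(pderiv ^^ n) (B' R1) = 0"
      using Suc.prems(1) by (simp add: B'_def funpow_swap1)
    from Suc.IH[OF this sum0] have B'0: "\<forall>R\<in>insert R1 S. B' R = 0" .
    have BS: "B R = 0" if "R \<in> S" for R
    proof (rule pderiv_plus_mult_eq_0D)
      show "pderiv (B R) + B R * (pderiv R - pderiv R1) = 0"
        using B'0 that unfolding B'_def by blast
      show "pderiv R - pderiv R1 \<noteq> 0"
      proof
        assume "pderiv R - pderiv R1 = 0"
        then have "pderiv (R - R1) = 0" by (simp add: pderiv_diff)
        then have "degree (R - R1) = 0" by (simp add: pderiv_eq_0_iff)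
        then obtain k where k: "R - R1 = [:k:]" by (metis degree_eq_zeroE)
        have "coeff (R - R1) 0 = 0" using insert.prems(1) that by simp
        with k have "R = R1" by simp
        with that insert.hyps show False by simp
      qed
    qed
    have "poly (B R1) z = 0" for z
      using Suc.prems(2)[of z] insert.hyps BS by simp
    then have "B R1 = 0" using poly_all_0_iff_0 by blast
    with BS show ?case by simp
  qed
  have "(pderiv ^^ Suc (degree (A R1))) (A R1) = 0"
  proof -
    have "(pderiv ^^ Suc n) p = 0" if "degree p \<le> n" for n and p :: "complex poly"
      using that
    proof (induction n arbitrary: p)
      case 0
      then show ?case by (simp add: pderiv_eq_0_iff)
    next
      case (Suc n)
      have "degree (pderiv p) \<le> n" using Suc.prems by (simp add: degree_pderiv)
      from Suc.IH[OF this] show ?case by (simp add: funpow_swap1)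
    qed
    then show ?thesis by simp
  qed
  from claim[OF this insert.prems(2)] show ?case .
qed

text \<open>
  Exponents that differ by a constant give proportional exponentials, so they are collected
  first. After that the exponentials are independent, and the terms with a given coefficient of
  \<open>z ^ m\<close> in the exponent form a union of collected classes.
\<close>

lemma exp_poly_group_by_coeff:
  fixes c :: "'i \<Rightarrow> complex" and R :: "'i \<Rightarrow> complex poly"
  assumes "finite I" and "m > 0"
    and zero: "\<And>z. (\<Sum>i\<in>I. c i * exp (poly (R i) z)) = 0"
  shows "(\<Sum>i\<in>I. if coeff (R i) m = a then c i * exp (poly (R i) z) else 0) = 0"
proof -
  define N where "N i = R i - [:coeff (R i) 0:]" for i
  define A where "A s = [:(\<Sum>i | i \<in> I \<and> N i = s. c i * exp (coeff (R i) 0)):]" for s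
  have e: "exp (poly (R i) z) = exp (coeff (R i) 0) * exp (poly (N i) z)" for i z
    by (simp add: N_def flip: exp_add)
  have fin: "finite (N ` I)" using \<open>finite I\<close> by simp
  have grp: "(\<Sum>i\<in>I. g i) = (\<Sum>s\<in>N ` I. \<Sum>i | i \<in> I \<and> N i = s. g i)" for g :: "'i \<Rightarrow> complex"
    using sum.image_gen[OF \<open>finite I\<close>, of g N] by simp
  have "(\<Sum>s\<in>N ` I. poly (A s) z * exp (poly s z)) = 0" for z
    using zero[of z] unfolding grp[of "\<lambda>i. c i * exp (poly (R i) z)"]
    by (auto simp: A_def e sum_distrib_right mult.assoc intro!: sum.cong elim!: trans[rotated])
  then have A0: "\<forall>s\<in>N ` I. A s = 0"
    by (intro exp_poly_independent fin) (auto simp: N_def)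
  have "(\<Sum>i | i \<in> I \<and> N i = s. if coeff (R i) m = a then c i * exp (poly (R i) z) else 0) = 0"
    if s: "s \<in> N ` I" for s
  proof -
    have cm: "coeff (R i) m = coeff (N i) m" for i
      using \<open>m > 0\<close> by (cases m) (simp_all add: N_def)
    have "(\<Sum>i | i \<in> I \<and> N i = s. if coeff (R i) m = a then c i * exp (poly (R i) z) else 0)
        = (\<Sum>i | i \<in> I \<and> N i = s. c i * exp (coeff (R i) 0)) * (if coeff s m = a then exp (poly s z) else 0)"
      by (auto simp: cm e sum_distrib_right intro!: sum.cong)
    also have "(\<Sum>i | i \<in> I \<and> N i = s. c i * exp (coeff (R i) 0)) = 0"
      using A0 s by (auto simp: A_def)
    finally show ?thesis by simp
  qed
  then show ?thesis by (subst grp) simp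
qed

lemma exp_poly_group_list:
  fixes cs :: "(complex \<times> complex poly) list"
  assumes "m > 0" and zero: "\<And>z. (\<Sum>(c, R)\<leftarrow>cs. c * exp (poly R z)) = 0"
  shows "(\<Sum>(c, R)\<leftarrow>cs. if coeff R m = a then c * exp (poly R z) else 0) = 0"
proof -
  have "(\<Sum>i\<in>{..<length cs}. if coeff (snd (cs ! i)) m = a
          then fst (cs ! i) * exp (poly (snd (cs ! i)) z) else 0) = 0"
    using zero by (intro exp_poly_group_by_coeff \<open>m > 0\<close>)
      (simp_all add: sum_list_sum_nth atLeast0LessThan case_prod_beta)
  then show ?thesis by (simp add: sum_list_sum_nth atLeast0LessThan case_prod_beta)
qed

lemma coeff_pcompose_shift:
  fixes P :: "complex poly"
  assumes "degree P \<le> m"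
  shows "coeff (pcompose P [:c, 1:]) m = coeff P m"
proof (cases "degree P = m")
  case True
  then show ?thesis using lead_coeff_comp[of "[:c, 1:]" P] by (simp add: degree_pcompose)
next
  case False
  then show ?thesis using assms by (simp add: coeff_eq_0 degree_pcompose)
qed

section \<open>Exponentials related to their own shifts\<close>

text \<open>
  The relation is the one satisfied by \<open>exp P = (g - e1) / (f - e1)\<close> and
  \<open>exp Q = (g - e2) / (f - e2)\<close> for the difference \<open>g\<close> of \<open>f\<close>. It is decided by looking at one or
  two groups of terms in each of the five cases for the leading coefficients \<open>p\<close>, \<open>q\<close>.
\<close>

lemma shifted_exponentials_no_relation:
  fixes P Q :: "complex poly" and c e1 e2 :: complex
  defines "P' \<equiv> pcompose P [:c, 1:]" and "Q' \<equiv> pcompose Q [:c, 1:]"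
  assumes "e1 \<noteq> e2" and nonconst: "degree P > 0 \<or> degree Q > 0"
    and PQ: "exp (poly P z0) \<noteq> exp (poly Q z0)"
    and P1: "exp (poly P z1) \<noteq> 1" and Q1: "exp (poly Q z2) \<noteq> 1"
    and rel: "\<And>z. (e2 - e1) * exp (poly P z) - (e2 - e1) * exp (poly Q z)
      - (e2 - e1) * exp (poly P' z) + (e2 - e1) * exp (poly Q' z)
      + e1 * exp (poly P z) * exp (poly Q' z) - e1 * exp (poly Q z) * exp (poly Q' z)
      - e2 * exp (poly P z) * exp (poly P' z) + e2 * exp (poly P' z) * exp (poly Q z)
      + (e2 - e1) * exp (poly P z) * exp (poly P' z) * exp (poly Q z)
      - (e2 - e1) * exp (poly P z) * exp (poly Q z) * exp (poly Q' z) = 0"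
  shows False
proof -
  define d where "d = e2 - e1"
  have "d \<noteq> 0" using \<open>e1 \<noteq> e2\<close> by (simp add: d_def)
  define m where "m = max (degree P) (degree Q)"
  have "m > 0" using nonconst by (auto simp: m_def)
  define p q where "p = coeff P m" and "q = coeff Q m"
  have cP: "coeff P m = p" "coeff P' m = p" "coeff Q m = q" "coeff Q' m = q"
    by (simp_all add: p_def q_def P'_def Q'_def m_def coeff_pcompose_shift)
  have pq: "p \<noteq> 0 \<or> q \<noteq> 0"
  proof (cases "degree P \<ge> degree Q")
    case True
    then show ?thesis using \<open>m > 0\<close> by (auto simp: p_def m_def max_def split: if_splits)
  next
    case False
    then show ?thesis using \<open>m > 0\<close> by (auto simp: q_def m_def max_def split: if_splits)
  qed
  define X Y X' Y' where "X z = exp (poly P z)" and "Y z = exp (poly Q z)"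
    and "X' z = exp (poly P' z)" and "Y' z = exp (poly Q' z)" for z
  note XY_defs = X_def Y_def X'_def Y'_def
  have nz: "X z \<noteq> 0" "Y z \<noteq> 0" "X' z \<noteq> 0" "Y' z \<noteq> 0" for z
    by (simp_all add: XY_defs)
  have shift: "X' z = X (z + c)" "Y' z = Y (z + c)" for z
    by (simp_all add: XY_defs P'_def Q'_def poly_pcompose add.commute)
  define cs where "cs = [(d, P), (-d, Q), (-d, P'), (d, Q'), (e1, P + Q'), (-e1, Q + Q'),
      (-e2, P + P'), (e2, P' + Q), (d, P + P' + Q), (-d, P + Q + Q')]"
  have "(\<Sum>(c, R)\<leftarrow>cs. c * exp (poly R z)) = 0" for z
    using rel[of z] by (simp add: cs_def d_def exp_add algebra_simps)
  then have "(\<Sum>(c, R)\<leftarrow>cs. if coeff R m = a then c * exp (poly R z) else 0) = 0" for a z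
    using \<open>m > 0\<close> by (intro exp_poly_group_list)
  then have G: "(if p = a then d * X z else 0) + ((if q = a then - d * Y z else 0)
      + ((if p = a then - d * X' z else 0) + ((if q = a then d * Y' z else 0)
      + ((if p + q = a then e1 * X z * Y' z else 0) + ((if 2 * q = a then - e1 * Y z * Y' z else 0)
      + ((if 2 * p = a then - e2 * X z * X' z else 0) + ((if p + q = a then e2 * X' z * Y z else 0)
      + ((if 2 * p + q = a then d * X z * X' z * Y z else 0)
      + (if p + 2 * q = a then - d * X z * Y z * Y' z else 0))))))))) = 0" for a z
    by (simp only: cs_def list.map sum_list.Cons sum_list.Nil case_prod_conv coeff_add cP
        poly_add exp_add XY_defs mult.assoc mult_2 add_0_right add.assoc)
  consider "p = q" "p \<noteq> 0" | "q = - p" "p \<noteq> 0" | "p = 0" "q \<noteq> 0" | "q = 0" "p \<noteq> 0"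
    | "p \<noteq> 0" "q \<noteq> 0" "p \<noteq> q" "q \<noteq> - p"
    using pq by blast
  then show False
  proof cases
    \<comment> \<open>the terms with coefficient \<open>3p\<close> force equality of the shifted exponentials\<close>
    case 1
    have "3 * p \<noteq> p" "3 * p \<noteq> 2 * p" "p + p \<noteq> 3 * p" using \<open>p \<noteq> 0\<close> by auto
    then have "d * X z * X' z * Y z = d * X z * Y z * Y' z" for z
      using G[of "3 * p" z] 1 by simp
    then have "X' z = Y' z" for z using nz \<open>d \<noteq> 0\<close> by simp
    from this[of "z0 - c"] show False using PQ by (simp add: shift XY_defs)
  next
    \<comment> \<open>coefficients \<open>2p\<close> and \<open>-2p\<close> belong to single terms\<close>
    case 2
    have ne: "p \<noteq> 2 * p" "- p \<noteq> 2 * p" "- (2 * p) \<noteq> 2 * p" "- (2 * p) \<noteq> p" "- (2 * p) \<noteq> - p"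
      "p \<noteq> - (2 * p)" "2 * p \<noteq> - (2 * p)" "- p \<noteq> - (2 * p)"
      using \<open>p \<noteq> 0\<close> by (auto simp: eq_neg_iff_add_eq_0 neg_eq_iff_add_eq_0)
    then have "e2 = 0" using G[of "2 * p" 0] 2 nz by simp
    moreover have "e1 = 0" using G[of "- (2 * p)" 0] 2 nz ne by simp
    ultimately show False using \<open>e1 \<noteq> e2\<close> by simp
  next
    \<comment> \<open>coefficient \<open>2q\<close> makes \<open>exp P\<close> constant, and coefficient \<open>0\<close> identifies the constant as \<open>1\<close>\<close>
    case 3
    then have "(d * X z + e1) * Y z * Y' z = 0" for z
      using G[of "2 * q" z] by (simp add: algebra_simps neg_eq_iff_add_eq_0)
    then have X: "d * X z = - e1" for z using nz by (simp add: eq_neg_iff_add_eq_0)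
    then have "X' z = X z" for z using \<open>d \<noteq> 0\<close> unfolding shift by (metis mult_cancel_left)
    then have "e2 = 0" using G[of 0 0] 3 nz by simp
    then have "X z1 = 1" using X[of z1] \<open>d \<noteq> 0\<close> by (simp add: d_def)
    then show False using P1 by (simp add: X_def)
  next
    case 4
    then have "(d * Y z - e2) * X z * X' z = 0" for z
      using G[of "2 * p" z] by (simp add: algebra_simps neg_eq_iff_add_eq_0)
    then have Y: "d * Y z = e2" for z using nz by simp
    then have "Y' z = Y z" for z using \<open>d \<noteq> 0\<close> unfolding shift by (metis mult_cancel_left)
    then have "e1 = 0" using G[of 0 0] 4 nz by simp
    then have "Y z2 = 1" using Y[of z2] \<open>d \<noteq> 0\<close> by (simp add: d_def)
    then show False using Q1 by (simp add: Y_def)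
  next
    \<comment> \<open>the term with coefficient \<open>2p + q\<close> is isolated unless \<open>q = 2p\<close>; then \<open>p + 2q = 5p\<close> is isolated\<close>
    case 5
    show False
    proof (cases "q = 2 * p")
      case True
      have "p \<noteq> 5 * p" "2 * p \<noteq> 5 * p" "3 * p \<noteq> 5 * p" "4 * p \<noteq> 5 * p" using \<open>p \<noteq> 0\<close> by auto
      then have "d * X 0 * Y 0 * Y' 0 = 0"
        using G[of "5 * p" 0] by (simp add: True)
      then show False using nz \<open>d \<noteq> 0\<close> by simp
    next
      case False
      have "p \<noteq> 2 * p + q" "p + 2 * q \<noteq> 2 * p + q" "2 * q \<noteq> 2 * p + q" "q \<noteq> 2 * p + q"
         "p + q \<noteq> 2 * p + q" "2 * p \<noteq> 2 * p + q"
        using 5 False by (auto simp: eq_neg_iff_add_eq_0 algebra_simps)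
      then have "d * X 0 * X' 0 * Y 0 = 0"
        using G[of "2 * p + q" 0] by simp
      then show False using nz \<open>d \<noteq> 0\<close> by simp
    qed
  qed
qed

section \<open>Poisson integral, Harnack inequality and polynomial growth\<close>

text \<open>
  For fixed \<open>w\<close>, Cauchy's formula at \<open>w\<close> for
  \<open>L u * (r\<^sup>2 - \<bar>w\<bar>\<^sup>2) / (r\<^sup>2 - cnj w * u)\<close> turns the Cauchy kernel into the Poisson kernel, because
  \<open>r\<^sup>2 = u * cnj u\<close> on the circle.
\<close>

lemma poisson_integral:
  fixes L :: "complex \<Rightarrow> complex"
  assumes contL: "continuous_on (cball 0 r) L" and holL: "L holomorphic_on ball 0 r"
    and w: "cmod w < r"
  shows "((\<lambda>t. Re (L (of_real r * cis t)) * ((r\<^sup>2 - (cmod w)\<^sup>2) / (cmod (of_real r * cis t - w))\<^sup>2))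
           has_integral 2 * pi * Re (L w)) {0..2*pi}"
proof -
  have r: "r > 0" using w norm_ge_zero[of w] by linarith
  define k :: complex where "k = of_real (r\<^sup>2 - (cmod w)\<^sup>2)"
  have "(cmod w)\<^sup>2 < r\<^sup>2" using w by (intro power_strict_mono) auto
  then have k0: "k \<noteq> 0" by (simp add: k_def del: of_real_diff of_real_power)
  have kw: "k = of_real r ^ 2 - cnj w * w"
    by (simp add: k_def complex_norm_square mult.commute flip: of_real_power)
  have den: "of_real r ^ 2 - cnj w * u \<noteq> 0" if "cmod u \<le> r" for u
  proof
    assume "of_real r ^ 2 - cnj w * u = 0"
    then have "cmod (of_real r ^ 2) = cmod (cnj w * u)" by simp
    then have "r\<^sup>2 = cmod w * cmod u" using r by (simp add: norm_mult norm_power)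
    moreover have "cmod w * cmod u \<le> cmod w * r" using that by (intro mult_left_mono) auto
    moreover have "cmod w * r < r * r" using w r by (intro mult_strict_right_mono) auto
    ultimately show False by (simp add: power2_eq_square)
  qed
  \<comment> \<open>the extra factor takes the value \<open>1\<close> at \<open>w\<close>\<close>
  define F where "F u = L u * k / (of_real r ^ 2 - cnj w * u)" for u
  have "continuous_on (cball 0 r) F" unfolding F_def
    by (intro continuous_intros contL) (use den in auto)
  moreover have "F holomorphic_on ball 0 r" unfolding F_def
    by (intro holomorphic_intros holL) (use den in auto)
  ultimately have "((\<lambda>u. F u / (u - w)) has_contour_integral (2 * of_real pi * \<i> * F w)) (circlepath 0 r)"
    using w by (intro Cauchy_integral_circlepath) auto
  moreover have "F w = L w" using k0 by (simp add: F_def kw)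
  ultimately have "((\<lambda>t. F (0 + of_real r * cis t) / (0 + of_real r * cis t - w) * of_real r * \<i> * cis t)
      has_integral (2 * of_real pi * \<i> * L w)) {0..2*pi}"
    unfolding circlepath_def by (subst (asm) has_contour_integral_part_circlepath_iff) auto
  then have "((\<lambda>t. - \<i> * (F (0 + of_real r * cis t) / (0 + of_real r * cis t - w) * of_real r * \<i> * cis t))
      has_integral - \<i> * (2 * of_real pi * \<i> * L w)) {0..2*pi}"
    by (rule has_integral_mult_right)
  moreover have "- \<i> * (2 * of_real pi * \<i> * L w) = 2 * of_real pi * L w" by (simp add: complex_eq_iff)
  ultimately have "((\<lambda>t. - \<i> * (F (of_real r * cis t) / (of_real r * cis t - w) * of_real r * \<i> * cis t))
      has_integral (2 * of_real pi * L w)) {0..2*pi}"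
    by (simp only: add_0_left)
  moreover have "- \<i> * (F (of_real r * cis t) / (of_real r * cis t - w) * of_real r * \<i> * cis t)
      = L (of_real r * cis t) * of_real ((r\<^sup>2 - (cmod w)\<^sup>2) / (cmod (of_real r * cis t - w))\<^sup>2)" for t
  proof -
    define u where "u = of_real r * cis t"
    have u: "cmod u = r" using r by (simp add: u_def norm_mult)
    have "u \<noteq> 0" "u \<noteq> w" using u w r by auto
    have uu: "of_real r ^ 2 = u * cnj u"
      using complex_norm_square[of u] u by (simp flip: of_real_power)
    have nsq: "of_real ((cmod (u - w))\<^sup>2) = (u - w) * (cnj u - cnj w)"
      using complex_norm_square[of "u - w"] by simp
    have ne: "cnj u - cnj w \<noteq> 0" using \<open>u \<noteq> w\<close> by (metis complex_cnj_cancel_iff right_minus_eq)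
    have "- \<i> * (a * b * \<i> * e) = a * (b * e)" for a b e :: complex
      by (simp add: complex_eq_iff algebra_simps)
    then have "- \<i> * (F u / (u - w) * of_real r * \<i> * cis t) = F u / (u - w) * u"
      unfolding u_def .
    also have "\<dots> = L u * k / (u * (cnj u - cnj w)) / (u - w) * u"
      by (simp add: F_def uu algebra_simps)
    also have "\<dots> = L u * (k / ((u - w) * (cnj u - cnj w)))"
    proof -
      have "a / (u * y) / x * u = a / (x * y)" for a x y using \<open>u \<noteq> 0\<close> by simp
      then show ?thesis by simp
    qed
    also have "k / ((u - w) * (cnj u - cnj w)) = of_real ((r\<^sup>2 - (cmod w)\<^sup>2) / (cmod (u - w))\<^sup>2)"
      unfolding k_def nsq[symmetric] by simp
    finally show ?thesis by (simp add: u_def)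
  qed
  ultimately have "((\<lambda>t. L (of_real r * cis t) * of_real ((r\<^sup>2 - (cmod w)\<^sup>2) / (cmod (of_real r * cis t - w))\<^sup>2))
      has_integral (2 * of_real pi * L w)) {0..2*pi}"
    by simp
  from has_integral_linear[OF this bounded_linear_Re] show ?thesis
    by (simp add: o_def)
qed

text \<open>
  The Poisson kernel is nonnegative, and at most \<open>(r + \<bar>w\<bar>) / (r - \<bar>w\<bar>) \<le> 3\<close> for \<open>\<bar>w\<bar> \<le> r / 2\<close>, so
  the negative part of \<open>Re L\<close> can be dropped. If \<open>f = exp L\<close>, the right side is three times the proximity function of \<open>f\<close>.
\<close>

lemma poisson_upper_bound:
  assumes contL: "continuous_on (cball 0 r) L" and holL: "L holomorphic_on ball 0 r"
    and r: "r > 0" and w: "cmod w \<le> r / 2"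
  shows "Re (L w) \<le> 3 * (1 / (2 * pi) * integral {0..2*pi} (\<lambda>t. max 0 (Re (L (of_real r * cis t)))))"
proof -
  let ?K = "\<lambda>t. (r\<^sup>2 - (cmod w)\<^sup>2) / (cmod (of_real r * cis t - w))\<^sup>2"
  have wr: "cmod w < r" using w r by simp
  have K: "0 \<le> ?K t" "?K t \<le> 3" for t
  proof -
    show "0 \<le> ?K t" using wr by (intro divide_nonneg_nonneg) (auto simp: power_mono)
    have "r - cmod w \<le> cmod (of_real r * cis t - w)"
      using norm_triangle_ineq2[of "of_real r * cis t" w] r by (simp add: norm_mult)
    then have "(r - cmod w)\<^sup>2 \<le> (cmod (of_real r * cis t - w))\<^sup>2"
      using wr by (intro power_mono) auto
    then have "?K t \<le> (r\<^sup>2 - (cmod w)\<^sup>2) / (r - cmod w)\<^sup>2"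
      using wr \<open>r - cmod w \<le> cmod (of_real r * cis t - w)\<close>
      by (intro divide_left_mono mult_pos_pos zero_less_power) (auto simp: power_mono)
    also have "\<dots> = ((r + cmod w) * (r - cmod w)) / ((r - cmod w) * (r - cmod w))"
      by (simp only: power2_eq_square square_diff_square_factored)
    also have "\<dots> = (r + cmod w) / (r - cmod w)"
      using wr by simp
    also have "\<dots> \<le> 3" using w wr by (simp add: divide_simps)
    finally show "?K t \<le> 3" .
  qed
  have "continuous_on {0..2*pi} (\<lambda>t. L (of_real r * cis t))"
    by (rule continuous_on_compose2[OF contL])
       (use r in \<open>auto intro!: continuous_intros simp: norm_mult\<close>)
  then have "(\<lambda>t. max 0 (Re (L (of_real r * cis t)))) integrable_on {0..2*pi}"
    by (intro integrable_continuous_interval continuous_intros)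
  then have int: "((\<lambda>t. 3 * max 0 (Re (L (of_real r * cis t)))) has_integral
      3 * integral {0..2*pi} (\<lambda>t. max 0 (Re (L (of_real r * cis t))))) {0..2*pi}"
    by (intro has_integral_mult_right integrable_integral)
  have "2 * pi * Re (L w) \<le> 3 * integral {0..2*pi} (\<lambda>t. max 0 (Re (L (of_real r * cis t))))"
  proof (rule has_integral_le[OF poisson_integral[OF contL holL wr] int])
    fix t
    have "Re (L (of_real r * cis t)) * ?K t \<le> max 0 (Re (L (of_real r * cis t))) * ?K t"
      using K by (intro mult_right_mono) auto
    also have "\<dots> \<le> max 0 (Re (L (of_real r * cis t))) * 3"
      using K by (intro mult_left_mono) auto
    finally show "Re (L (of_real r * cis t)) * ?K t \<le> 3 * max 0 (Re (L (of_real r * cis t)))" by simp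
  qed
  then show ?thesis by (simp add: field_simps)
qed

lemma harnack_upper:
  assumes contL: "continuous_on (cball 0 r) L" and holL: "L holomorphic_on ball 0 r"
    and r: "r > 0" and w: "cmod w \<le> r / 2" and nonneg: "\<And>z. cmod z = r \<Longrightarrow> 0 \<le> Re (L z)"
  shows "Re (L w) \<le> 3 * Re (L 0)"
proof -
  have "cmod (of_real r * cis t) = r" for t using r by (simp add: norm_mult)
  then have "max 0 (Re (L (of_real r * cis t))) = Re (L (of_real r * cis t))" for t
    using nonneg by (simp add: max_def)
  moreover have "((\<lambda>t. Re (L (of_real r * cis t))) has_integral 2 * pi * Re (L 0)) {0..2*pi}"
    using poisson_integral[OF contL holL, of 0] r by (simp add: norm_mult)
  ultimately show ?thesis
    using poisson_upper_bound[OF contL holL r w] by (simp add: integral_unique)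
qed

text \<open>
  The map \<open>w / (2M - w)\<close> sends the half plane \<open>Re w < M\<close> to the unit disc and fixes \<open>0\<close>, so the
  Schwarz lemma applies.
\<close>

lemma borel_caratheodory_half:
  fixes w :: "complex \<Rightarrow> complex"
  assumes hol: "w holomorphic_on ball 0 R" and "w 0 = 0" and R: "R > 0" and "M > 0"
    and Re: "\<And>z. cmod z < R \<Longrightarrow> Re (w z) < M" and z: "cmod z \<le> R / 2"
  shows "cmod (w z) \<le> 2 * M"
proof -
  define g where "g u = w (of_real R * u) / (2 * of_real M - w (of_real R * u))" for u
  have in_ball: "cmod (of_real R * u) < R" if "cmod u < 1" for u
    using that R by (simp add: norm_mult)
  have less: "cmod (w v) < cmod (2 * of_real M - w v)" if "cmod v < R" for v
  proof (rule power_less_imp_less_base[of _ 2])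
    have "4 * M * Re (w v) < 4 * M * M"
      using Re[OF that] \<open>M > 0\<close> by (intro mult_strict_left_mono) auto
    then show "(cmod (w v))\<^sup>2 < (cmod (2 * of_real M - w v))\<^sup>2"
      unfolding cmod_power2 by (simp add: power2_eq_square algebra_simps)
  qed auto
  have ne: "2 * of_real M - w v \<noteq> 0" if "cmod v < R" for v
    using less[OF that] by (metis norm_ge_zero norm_zero not_le)
  have gh: "g holomorphic_on ball 0 1" unfolding g_def
    by (intro holomorphic_intros holomorphic_on_compose_gen[OF _ hol, unfolded o_def])
       (use in_ball ne in auto)
  have g0: "g 0 = 0" using \<open>w 0 = 0\<close> by (simp add: g_def)
  have g1: "cmod (g u) < 1" if "cmod u < 1" for u
    using less[OF in_ball[OF that]] ne[OF in_ball[OF that]] by (simp add: g_def norm_divide)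
  have zR: "cmod (z / of_real R) \<le> 1 / 2" using z R by (simp add: norm_divide field_simps)
  have "cmod (g (z / of_real R)) \<le> cmod (z / of_real R)"
    by (rule Schwarz_Lemma(1)[OF gh g0 g1]) (use zR in linarith)+
  then have "cmod (g (z / of_real R)) \<le> 1 / 2" using zR by (rule order_trans)
  moreover have "g (z / of_real R) = w z / (2 * of_real M - w z)" using R by (simp add: g_def)
  moreover have "2 * of_real M - w z \<noteq> 0" using z R by (intro ne) auto
  ultimately have "cmod (w z) \<le> cmod (2 * of_real M - w z) / 2"
    by (simp add: norm_divide field_simps)
  also have "\<dots> \<le> (2 * M + cmod (w z)) / 2"
    using norm_triangle_ineq4[of "2 * of_real M" "w z"] \<open>M > 0\<close> by (simp add: norm_mult)
  finally show ?thesis by simp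
qed

lemma entire_polynomial_if_Re_growth:
  fixes P :: "complex \<Rightarrow> complex" and C R0 :: real
  assumes hol: "P holomorphic_on UNIV"
    and growth: "\<And>R z. R \<ge> R0 \<Longrightarrow> cmod z \<le> R \<Longrightarrow> Re (P z) \<le> C * R ^ k"
  obtains p where "\<And>z. P z = poly p z"
proof -
  define B where "B = 2 * (\<bar>C\<bar> * 2 ^ k + cmod (P 0) + 1) + cmod (P 0)"
  have bound: "cmod (P z) \<le> B * cmod z ^ k" if z: "max 1 R0 \<le> cmod z" for z
  proof -
    define r where "r = cmod z"
    have r: "r \<ge> 1" "r \<ge> R0" using z by (auto simp: r_def)
    define M where "M = \<bar>C\<bar> * (2 * r) ^ k + cmod (P 0) + 1"
    have "cmod (P z - P 0) \<le> 2 * M"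
    proof (rule borel_caratheodory_half[where R = "2 * r" and w = "\<lambda>z. P z - P 0"])
      show "(\<lambda>z. P z - P 0) holomorphic_on ball 0 (2 * r)"
        by (intro holomorphic_intros holomorphic_on_subset[OF hol]) auto
      have "0 \<le> \<bar>C\<bar> * (2 * r) ^ k" using r by simp
      then show "M > 0" using norm_ge_zero[of "P 0"] unfolding M_def by linarith
      fix v assume "cmod v < 2 * r"
      then have "Re (P v) \<le> C * (2 * r) ^ k" using r by (intro growth) auto
      also have "\<dots> \<le> \<bar>C\<bar> * (2 * r) ^ k" using r by (intro mult_right_mono) auto
      finally show "Re (P v - P 0) < M"
        using abs_Re_le_cmod[of "P 0"] by (simp add: M_def)
    qed (use r in \<open>auto simp: r_def\<close>)
    then have "cmod (P z) \<le> 2 * M + cmod (P 0)"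
      using norm_triangle_ineq2[of "P z" "P 0"] by linarith
    also have "\<dots> = 2 * (\<bar>C\<bar> * 2 ^ k * r ^ k + (cmod (P 0) + 1) * 1) + cmod (P 0) * 1"
      by (simp add: M_def power_mult_distrib)
    also have "\<dots> \<le> 2 * (\<bar>C\<bar> * 2 ^ k * r ^ k + (cmod (P 0) + 1) * r ^ k) + cmod (P 0) * r ^ k"
      using one_le_power[OF r(1), of k] by (intro add_mono mult_left_mono) auto
    finally show ?thesis by (simp add: B_def r_def algebra_simps)
  qed
  define p where "p = (\<Sum>i\<le>k. monom ((deriv ^^ i) P 0 / fact i) i)"
  have "P z = poly p z" for z
  proof -
    have "P z = (\<Sum>i\<le>k. (deriv ^^ i) P 0 / fact i * z ^ i)"
      by (rule Liouville_polynomial[OF hol]) (rule bound)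
    then show ?thesis by (simp add: p_def poly_sum poly_monom)
  qed
  then show thesis by (rule that)
qed

section \<open>Blaschke factors\<close>

lemma remove_sings_analytic_nonzero:
  assumes mero: "f meromorphic_on A"
    and "\<And>z. z \<in> A \<Longrightarrow> \<forall>\<^sub>F w in at z. f w \<noteq> 0" and "\<And>z. z \<in> A \<Longrightarrow> zorder f z = 0"
  shows "remove_sings f analytic_on A" and "\<And>z. z \<in> A \<Longrightarrow> remove_sings f z \<noteq> 0"
proof -
  have *: "remove_sings f analytic_on {z} \<and> remove_sings f z \<noteq> 0" if z: "z \<in> A" for z
  proof -
    have iso: "isolated_singularity_at f z" and ness: "not_essential f z"
      using mero z by (auto simp: meromorphic_on_altdef)
    have "\<not> is_pole f z"
      using isolated_pole_imp_neg_zorder[OF iso] assms(3)[OF z] by auto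
    then obtain l where l: "f \<midarrow>z\<rightarrow> l" using ness by (auto simp: not_essential_def)
    have "l \<noteq> 0"
    proof
      assume "l = 0"
      then have "isolated_zero f z" using l assms(2)[OF z] by (simp add: isolated_zero_def)
      then show False using zorder_isolated_zero_pos'[OF _ iso] assms(3)[OF z] by simp
    qed
    then show ?thesis using remove_sings_analytic_at[OF iso l] remove_sings_eqI[OF l] by simp
  qed
  then show "remove_sings f analytic_on A" by (meson analytic_on_analytic_at)
  show "\<And>z. z \<in> A \<Longrightarrow> remove_sings f z \<noteq> 0" using * by blast
qed

text \<open>
  For \<open>\<bar>a\<bar> < r\<close>, a conformal map of the disc of radius \<open>r\<close> onto the unit disc with its zero at \<open>a\<close>.
\<close>

definition blaschke :: "real \<Rightarrow> complex \<Rightarrow> complex \<Rightarrow> complex" where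
  "blaschke r a z = of_real r * (z - a) / (of_real (r\<^sup>2) - cnj a * z)"

lemma blaschke_denom_nonzero:
  assumes "cmod a < r" "cmod z \<le> r"
  shows "of_real (r\<^sup>2) - cnj a * z \<noteq> 0"
proof
  have r: "r > 0" using assms norm_ge_zero[of a] by linarith
  assume "of_real (r\<^sup>2) - cnj a * z = 0"
  then have "cmod (of_real (r\<^sup>2)) = cmod (cnj a * z)" by simp
  then have "r\<^sup>2 = cmod a * cmod z" using r by (simp add: norm_mult norm_power)
  moreover have "cmod a * cmod z \<le> cmod a * r" using assms by (intro mult_left_mono) auto
  moreover have "cmod a * r < r * r" using assms r by (intro mult_strict_right_mono) auto
  ultimately show False by (simp add: power2_eq_square)
qed

text \<open>
  This identity gives both the bound \<open>1\<close> inside the disc and the modulus \<open>1\<close> on its boundary.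
\<close>

lemma blaschke_denom_norm:
  "(cmod (of_real (r\<^sup>2) - cnj a * z))\<^sup>2 - (cmod (of_real r * (z - a)))\<^sup>2
     = (r\<^sup>2 - (cmod a)\<^sup>2) * (r\<^sup>2 - (cmod z)\<^sup>2)"
  unfolding cmod_power2 by (simp add: power2_eq_square algebra_simps)

lemma norm_blaschke_le_1:
  assumes "cmod a < r" "cmod z \<le> r"
  shows "cmod (blaschke r a z) \<le> 1"
proof -
  have "0 \<le> (r\<^sup>2 - (cmod a)\<^sup>2) * (r\<^sup>2 - (cmod z)\<^sup>2)"
    using assms by (intro mult_nonneg_nonneg) (auto simp: power_mono)
  then have "(cmod (of_real r * (z - a)))\<^sup>2 \<le> (cmod (of_real (r\<^sup>2) - cnj a * z))\<^sup>2"
    using blaschke_denom_norm[of r a z] by linarith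
  then have "cmod (of_real r * (z - a)) \<le> cmod (of_real (r\<^sup>2) - cnj a * z)"
    by (rule power2_le_imp_le) auto
  then show ?thesis
    using blaschke_denom_nonzero[OF assms] unfolding blaschke_def norm_divide
    by (simp add: divide_le_eq)
qed

lemma norm_blaschke_eq_1:
  assumes "cmod a < r" "cmod z = r"
  shows "cmod (blaschke r a z) = 1"
proof -
  have "(cmod (of_real r * (z - a)))\<^sup>2 = (cmod (of_real (r\<^sup>2) - cnj a * z))\<^sup>2"
    using blaschke_denom_norm[of r a z] assms by simp
  then have "cmod (of_real r * (z - a)) = cmod (of_real (r\<^sup>2) - cnj a * z)"
    by (simp add: power2_eq_iff_nonneg)
  then show ?thesis
    using blaschke_denom_nonzero[of a r z] assms unfolding blaschke_def norm_divide by simp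
qed

text \<open>
  Controls a Blaschke product from below at a point that keeps a distance from its zeros.
\<close>

lemma norm_blaschke_ge:
  assumes "cmod a < r" "cmod z \<le> r"
  shows "cmod (z - a) / (2 * r) \<le> cmod (blaschke r a z)"
proof -
  have r: "r > 0" using assms norm_ge_zero[of a] by linarith
  have "cmod (of_real (r\<^sup>2) - cnj a * z) \<le> r\<^sup>2 + cmod a * cmod z"
    using norm_triangle_ineq4[of "of_real (r\<^sup>2)" "cnj a * z"] r by (simp add: norm_mult norm_power)
  also have "cmod a * cmod z \<le> r * r" using assms r by (intro mult_mono) auto
  finally have le: "cmod (of_real (r\<^sup>2) - cnj a * z) \<le> 2 * r\<^sup>2" by (simp add: power2_eq_square)
  have pos: "0 < cmod (of_real (r\<^sup>2) - cnj a * z)" using blaschke_denom_nonzero[OF assms] by simp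
  have "cmod (z - a) / (2 * r) = r * cmod (z - a) / (2 * r\<^sup>2)"
    using r by (simp add: power2_eq_square)
  also have "\<dots> \<le> r * cmod (z - a) / cmod (of_real (r\<^sup>2) - cnj a * z)"
    using le pos r by (intro divide_left_mono) auto
  also have "\<dots> = cmod (blaschke r a z)"
    using r by (simp add: blaschke_def norm_divide norm_mult)
  finally show ?thesis .
qed

lemma blaschke_analytic:
  assumes "cmod a < r" shows "blaschke r a analytic_on cball 0 r"
  unfolding blaschke_def
  by (intro analytic_intros) (use blaschke_denom_nonzero[OF assms] in auto)

lemma blaschke_eq_0_iff:
  assumes "cmod a < r" "cmod z \<le> r"
  shows "blaschke r a z = 0 \<longleftrightarrow> z = a"
proof -
  have "r > 0" using assms norm_ge_zero[of a] by linarith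
  then show ?thesis using blaschke_denom_nonzero[OF assms] by (simp add: blaschke_def)
qed

lemma eventually_blaschke_nonzero:
  assumes "cmod a < r" shows "\<forall>\<^sub>F w in at z. blaschke r a w \<noteq> 0"
proof -
  have r: "r > 0" using assms norm_ge_zero[of a] by linarith
  define S where "S = {w. w \<noteq> a \<and> of_real (r\<^sup>2) - cnj a * w \<noteq> 0}"
  have "finite (-S)"
  proof (cases "a = 0")
    case True
    then show ?thesis using r by (simp add: S_def Compl_eq)
  next
    case False
    then have "-S \<subseteq> {a, of_real (r\<^sup>2) / cnj a}" by (auto simp: S_def field_simps)
    then show ?thesis using finite_subset by blast
  qed
  then have "\<forall>\<^sub>F w in at z. w \<notin> -S" by (metis islimpt_finite islimpt_iff_eventually)
  then show ?thesis by eventually_elim (use r in \<open>auto simp: S_def blaschke_def\<close>)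
qed

lemma zorder_blaschke:
  assumes "cmod a < r" "cmod z \<le> r"
  shows "zorder (blaschke r a) z = (if z = a then 1 else 0)"
proof (cases "z = a")
  case True
  have r: "r > 0" using assms norm_ge_zero[of a] by linarith
  define U where "U = {w. of_real (r\<^sup>2) - cnj a * w \<noteq> 0}"
  have "open U" unfolding U_def by (intro open_Collect_neq continuous_intros)
  have "zorder (blaschke r a) a = 1"
  proof (rule zorder_eqI[where S = U and g = "\<lambda>w. of_real r / (of_real (r\<^sup>2) - cnj a * w)"])
    show "a \<in> U" using blaschke_denom_nonzero[of a r a] assms by (simp add: U_def)
    show "(\<lambda>w. of_real r / (of_real (r\<^sup>2) - cnj a * w)) holomorphic_on U"
      by (intro holomorphic_intros) (auto simp: U_def)
  qed (use \<open>open U\<close> r blaschke_denom_nonzero[of a r a] assms in \<open>auto simp: blaschke_def\<close>)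
  with True show ?thesis by simp
next
  case False
  have "blaschke r a analytic_on {z}"
    using blaschke_analytic[OF assms(1)] assms(2) by (rule_tac analytic_on_subset) auto
  moreover have "blaschke r a z \<noteq> 0" using False blaschke_eq_0_iff[OF assms] by simp
  ultimately show ?thesis using False by (auto simp: zorder_eq_0I)
qed

lemma finite_zorder_nonzero:
  assumes mero: "f meromorphic_on K" and "compact K" and nz: "\<And>z. z \<in> K \<Longrightarrow> \<forall>\<^sub>F w in at z. f w \<noteq> 0"
  shows "finite {a \<in> K. zorder f a \<noteq> 0}"
proof (rule ccontr)
  let ?Z = "{a \<in> K. zorder f a \<noteq> 0}"
  assume "infinite ?Z"
  then obtain z where "z \<in> K" "z islimpt ?Z"
    using \<open>compact K\<close> unfolding compact_eq_Bolzano_Weierstrass by blast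
  have "isolated_singularity_at f z" using mero \<open>z \<in> K\<close> by (auto simp: meromorphic_on_altdef)
  then have "\<forall>\<^sub>F w in at z. f analytic_on {w}"
    using meromorphic_on_imp_not_islimpt_singularities[OF mero \<open>z \<in> K\<close>] by (simp add: islimpt_iff_eventually)
  with nz[OF \<open>z \<in> K\<close>] have "\<forall>\<^sub>F w in at z. w \<notin> ?Z"
    by eventually_elim (auto simp: zorder_eq_0I)
  with \<open>z islimpt ?Z\<close> show False by (simp add: islimpt_iff_eventually)
qed

text \<open>
  All zeros and poles in the disc are moved into factors of modulus \<open>1\<close> on the boundary circle;
  the remaining factor is zero-free and has the boundary modulus of \<open>f\<close>.
\<close>

lemma blaschke_factorization:
  assumes mero: "f meromorphic_on cball 0 r" and nz: "\<And>z. cmod z \<le> r \<Longrightarrow> \<forall>\<^sub>F w in at z. f w \<noteq> 0"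
    and circ: "\<And>z. cmod z = r \<Longrightarrow> zorder f z = 0"
  defines "Z \<equiv> {a \<in> cball 0 r. zorder f a \<noteq> 0}"
  obtains F where "F analytic_on cball 0 r" "\<And>z. cmod z \<le> r \<Longrightarrow> F z \<noteq> 0"
    "\<And>z. cmod z \<le> r \<Longrightarrow> \<forall>\<^sub>F w in at z. f w = F w * (\<Prod>a\<in>Z. blaschke r a w powi zorder f a)"
proof -
  have finZ: "finite Z" unfolding Z_def by (rule finite_zorder_nonzero[OF mero]) (use nz in auto)
  have Zlt: "cmod a < r" if "a \<in> Z" for a
    using that circ[of a] by (auto simp: Z_def order.strict_iff_order)
  define W where "W w = (\<Prod>a\<in>Z. blaschke r a w powi zorder f a)" for w
  have bl_mero: "blaschke r a meromorphic_on cball 0 r" if "a \<in> Z" for a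
    by (intro analytic_on_imp_meromorphic_on blaschke_analytic Zlt that)
  have Wmero: "W meromorphic_on cball 0 r"
    unfolding W_def by (intro meromorphic_intros bl_mero)
  have Wnz: "\<forall>\<^sub>F w in at z. W w \<noteq> 0" for z
  proof -
    have "\<forall>\<^sub>F w in at z. \<forall>a\<in>Z. blaschke r a w \<noteq> 0"
      using finZ by (intro eventually_ball_finite) (auto intro: eventually_blaschke_nonzero Zlt)
    then show ?thesis by eventually_elim (auto simp: W_def finZ)
  qed
  have Word: "zorder W z = zorder f z" if z: "cmod z \<le> r" for z
  proof -
    have blm: "blaschke r a meromorphic_on {z}" if "a \<in> Z" for a
      by (rule meromorphic_on_subset[OF bl_mero[OF that]]) (use z in auto)
    have "zorder W z = (\<Sum>a\<in>Z. zorder (\<lambda>w. blaschke r a w powi zorder f a) z)"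
      unfolding W_def by (rule zorder_prod)
        (use Wnz[of z] blm in \<open>auto simp: W_def intro!: meromorphic_intros\<close>)
    also have "\<dots> = (\<Sum>a\<in>Z. if a = z then zorder f a else 0)"
    proof (rule sum.cong)
      fix a assume a: "a \<in> Z"
      have "zorder (\<lambda>w. blaschke r a w powi zorder f a) z = zorder f a * zorder (blaschke r a) z"
        by (rule zorder_power_int[OF blm[OF a]])
           (simp add: eventually_frequently eventually_blaschke_nonzero[OF Zlt[OF a]])
      then show "zorder (\<lambda>w. blaschke r a w powi zorder f a) z = (if a = z then zorder f a else 0)"
        using zorder_blaschke[OF Zlt[OF a] z] by auto
    qed simp
    also have "\<dots> = zorder f z" using z finZ by (simp add: Z_def)
    finally show ?thesis .
  qed
  define G where "G w = f w / W w" for w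
  have Gmero: "G meromorphic_on cball 0 r" unfolding G_def by (intro meromorphic_intros mero Wmero)
  have Gnz: "\<forall>\<^sub>F w in at z. G w \<noteq> 0" if "z \<in> cball 0 r" for z
    using nz[of z] Wnz[of z] that by (auto simp: G_def eventually_conj_iff)
  have Gord: "zorder G z = 0" if z: "z \<in> cball 0 r" for z
  proof -
    have "zorder G z = zorder f z - zorder W z" unfolding G_def
      by (rule zorder_divide)
         (use z nz[of z] Wnz[of z] in \<open>auto intro!: meromorphic_on_subset[OF mero] meromorphic_on_subset[OF Wmero] simp: eventually_frequently\<close>)
    then show ?thesis using Word z by simp
  qed
  note rs = remove_sings_analytic_nonzero[OF Gmero Gnz Gord]
  show thesis
  proof (rule that[of "remove_sings G"])
    show "remove_sings G analytic_on cball 0 r" by (rule rs(1))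
    show "remove_sings G z \<noteq> 0" if "cmod z \<le> r" for z using rs(2) that by simp
    show "\<forall>\<^sub>F w in at z. f w = remove_sings G w * (\<Prod>a\<in>Z. blaschke r a w powi zorder f a)"
      if z: "cmod z \<le> r" for z
    proof -
      have "isolated_singularity_at G z" using Gmero z by (auto simp: meromorphic_on_altdef)
      from eventually_remove_sings_eq_at[OF this] Wnz[of z] show ?thesis
        by eventually_elim (simp add: G_def W_def)
    qed
  qed
qed

section \<open>Quotients of bounded functions in a disc\<close>

text \<open>
  The function stays zero-free on a slightly larger disc, which makes the logarithm continuous up
  to the boundary.
\<close>

lemma analytic_logarithm_on_cball:
  assumes F: "F analytic_on cball 0 r" and nz: "\<And>z. cmod z \<le> r \<Longrightarrow> F z \<noteq> 0" and "r > 0"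
  obtains L where "L holomorphic_on ball 0 r" "continuous_on (cball 0 r) L"
    "\<And>z. cmod z \<le> r \<Longrightarrow> F z = exp (L z)"
proof -
  obtain V where V: "open V" "cball 0 r \<subseteq> V" "F holomorphic_on V"
    using F by (auto simp: analytic_on_holomorphic)
  define U where "U = V \<inter> F -` (-{0})"
  have "open U" unfolding U_def
    using V by (intro continuous_open_preimage holomorphic_on_imp_continuous_on) auto
  moreover have sub: "cball 0 r \<subseteq> U" using V nz by (auto simp: U_def)
  ultimately obtain \<epsilon> where \<epsilon>: "\<epsilon> > 0" "(\<Union>x\<in>cball 0 r. ball x \<epsilon>) \<subseteq> U"
    using compact_subset_open_imp_ball_epsilon_subset[of "cball 0 r" U] by auto
  have big: "ball 0 (r + \<epsilon>) \<subseteq> U"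
  proof
    fix z :: complex assume z: "z \<in> ball 0 (r + \<epsilon>)"
    show "z \<in> U"
    proof (cases "cmod z \<le> r")
      case True
      then show ?thesis using sub by auto
    next
      case False
      define x where "x = of_real (r / cmod z) * z"
      have "z \<noteq> 0" using False \<open>r > 0\<close> by auto
      then have "cmod x = r" using False \<open>r > 0\<close> by (simp add: x_def norm_mult norm_divide)
      have "z - x = of_real (1 - r / cmod z) * z" by (simp add: x_def algebra_simps)
      then have "cmod (z - x) = \<bar>1 - r / cmod z\<bar> * cmod z" by (simp only: norm_mult norm_of_real)
      also have "\<dots> = cmod z - r" using False \<open>r > 0\<close> \<open>z \<noteq> 0\<close> by (simp add: abs_if field_simps)
      finally have "z \<in> ball x \<epsilon>" using z by (simp add: dist_norm norm_minus_commute)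
      moreover have "x \<in> cball 0 r" using \<open>cmod x = r\<close> by simp
      ultimately show ?thesis using \<epsilon>(2) by blast
    qed
  qed
  have "F holomorphic_on ball 0 (r + \<epsilon>)" using big V(3) holomorphic_on_subset by (auto simp: U_def)
  moreover have "F z \<noteq> 0" if "z \<in> ball 0 (r + \<epsilon>)" for z using big that by (auto simp: U_def)
  ultimately obtain L where L: "L holomorphic_on ball 0 (r + \<epsilon>)" "\<And>z. z \<in> ball 0 (r + \<epsilon>) \<Longrightarrow> exp (L z) = F z"
    using holomorphic_logarithm_exists[of "ball 0 (r + \<epsilon>)" F 0] \<open>r > 0\<close> \<epsilon>(1) by auto
  show thesis
  proof (rule that[of L])
    show "L holomorphic_on ball 0 r" using L(1) \<epsilon>(1) by (auto intro: holomorphic_on_subset)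
    show "continuous_on (cball 0 r) L"
      using \<epsilon>(1) by (intro holomorphic_on_imp_continuous_on holomorphic_on_subset[OF L(1)]) auto
  qed (use L(2) \<epsilon>(1) in auto)
qed

lemma exists_regular_radius:
  assumes mero: "f meromorphic_on cball 0 b" and nz: "\<And>z. cmod z \<le> b \<Longrightarrow> \<forall>\<^sub>F w in at z. f w \<noteq> 0"
    and ab: "a < b"
  obtains r where "a < r" "r < b" "\<And>z. cmod z = r \<Longrightarrow> zorder f z = 0"
proof -
  have "finite {z \<in> cball 0 b. zorder f z \<noteq> 0}"
    by (rule finite_zorder_nonzero[OF mero]) (use nz in auto)
  then have "infinite ({a<..<b} - cmod ` {z \<in> cball 0 b. zorder f z \<noteq> 0})"
    using ab by (simp add: infinite_Ioo)
  then obtain r where "r \<in> {a<..<b} - cmod ` {z \<in> cball 0 b. zorder f z \<noteq> 0}"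
    using infinite_imp_nonempty by blast
  then show thesis by (intro that[of r]) auto
qed

lemma eventually_at_eq_imp_eq:
  fixes f g :: "complex \<Rightarrow> complex"
  assumes "\<forall>\<^sub>F w in at z. f w = g w" "isCont f z" "isCont g z"
  shows "f z = g z"
proof -
  have "f \<midarrow>z\<rightarrow> f z" "g \<midarrow>z\<rightarrow> g z" using assms by (auto simp: isCont_def)
  moreover have "g \<midarrow>z\<rightarrow> f z" using \<open>f \<midarrow>z\<rightarrow> f z\<close> assms(1) tendsto_cong by force
  ultimately show ?thesis using LIM_unique by blast
qed

lemma blaschke_power_analytic:
  assumes "\<And>a. a \<in> Z \<Longrightarrow> cmod a < r" "\<And>a. a \<in> Z \<Longrightarrow> 0 \<le> n a"
  shows "(\<lambda>w. \<Prod>a\<in>Z. blaschke r a w powi n a) analytic_on cball 0 r"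
proof -
  have "(\<lambda>w. \<Prod>a\<in>Z. blaschke r a w ^ nat (n a)) analytic_on cball 0 r"
    by (intro analytic_intros) (auto intro: blaschke_analytic assms)
  also have "(\<lambda>w. \<Prod>a\<in>Z. blaschke r a w ^ nat (n a)) = (\<lambda>w. \<Prod>a\<in>Z. blaschke r a w powi n a)"
    using assms(2) by (auto simp: power_int_def intro!: prod.cong ext)
  finally show ?thesis .
qed

lemma blaschke_power_norm_le_1:
  assumes "\<And>a. a \<in> Z \<Longrightarrow> cmod a < r" "\<And>a. a \<in> Z \<Longrightarrow> 0 \<le> n a" "cmod z \<le> r"
  shows "cmod (\<Prod>a\<in>Z. blaschke r a z powi n a) \<le> 1"
  unfolding prod_norm[symmetric]
  by (intro prod_le_1) (use assms norm_blaschke_le_1 in \<open>auto simp: power_int_def norm_power power_le_one\<close>)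

lemma blaschke_power_norm_eq_1:
  assumes "\<And>a. a \<in> Z \<Longrightarrow> cmod a < r" "cmod z = r"
  shows "cmod (\<Prod>a\<in>Z. blaschke r a z powi n a) = 1"
  unfolding prod_norm[symmetric]
  by (rule prod.neutral) (use assms norm_blaschke_eq_1 in \<open>auto simp: norm_power_int\<close>)

lemma analytic_on_cball_isCont:
  "f analytic_on cball 0 r \<Longrightarrow> cmod z \<le> r \<Longrightarrow> isCont f z"
  by (rule analytic_at_imp_isCont) (auto intro: analytic_on_subset)

text \<open>
  A substitute for the first main theorem. Write \<open>D = F W\<close> with a Blaschke product \<open>W\<close> and
  zero-free \<open>F\<close>. The maximum principle bounds \<open>h F\<close>, as it has the modulus of \<open>A\<close> on the circle, and
  the Harnack inequality for \<open>M - log \<bar>F\<bar> \<ge> 0\<close> bounds \<open>F\<close> from below.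
\<close>

lemma quotient_bound:
  fixes A D h :: "complex \<Rightarrow> complex"
  assumes R: "R > 0" and hol: "A holomorphic_on ball 0 R" "D holomorphic_on ball 0 R" "h holomorphic_on ball 0 R"
    and quot: "\<And>z. cmod z < R \<Longrightarrow> A z = h z * D z"
    and A: "\<And>z. cmod z < R \<Longrightarrow> cmod (A z) \<le> exp M"
    and D: "\<And>z. cmod z < R \<Longrightarrow> cmod (D z) \<le> exp M"
    and D0: "exp (- M) \<le> cmod (D 0)" and w: "cmod w \<le> R / 4"
  shows "cmod (h w) \<le> exp (6 * M)"
proof -
  have Dana: "D analytic_on ball 0 R" using hol(2) by (simp add: analytic_on_open)
  have "\<not> (\<forall>z\<in>ball 0 R. D z = 0)" 
  proof
    assume "\<forall>z\<in>ball 0 R. D z = 0"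
    then have "D 0 = 0" using R by simp
    then show False using D0 exp_gt_zero[of "- M"] by simp
  qed
  then have "\<forall>\<^sub>\<approx>z\<in>ball 0 R. D z \<noteq> 0"
    using nicely_meromorphic_imp_constant_or_avoid[of D "ball 0 R" 0]
      analytic_on_imp_nicely_meromorphic_on[OF Dana] by auto
  then have nz: "\<forall>\<^sub>F z in at x. D z \<noteq> 0" if "cmod x < R" for x
    using eventually_cosparse_imp_eventually_at that by fastforce
  have "\<exists>r. R / 2 < r \<and> r < 3 / 4 * R \<and> (\<forall>z. cmod z = r \<longrightarrow> zorder D z = 0)"
  proof (rule exists_regular_radius[of D "3 / 4 * R" "R / 2"])
    show "D meromorphic_on cball 0 (3 / 4 * R)"
      using R by (intro analytic_on_imp_meromorphic_on analytic_on_subset[OF Dana]) auto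
  qed (use R nz in auto)
  \<comment> \<open>a circle without zeros of \<open>D\<close>, so that all zeros to be removed lie strictly inside\<close>
  then obtain r where r: "R / 2 < r" "r < R" and circ: "\<And>z. cmod z = r \<Longrightarrow> zorder D z = 0"
    using R by fastforce
  have cb: "cball 0 r \<subseteq> ball 0 R" using r by auto
  define Z where "Z = {a \<in> cball 0 r. zorder D a \<noteq> 0}"
  have Dr: "D analytic_on cball 0 r" by (rule analytic_on_subset[OF Dana cb])
  have nz': "\<forall>\<^sub>F w in at z. D w \<noteq> 0" if "cmod z \<le> r" for z using nz that r by simp
  obtain F where F: "F analytic_on cball 0 r" "\<And>z. cmod z \<le> r \<Longrightarrow> F z \<noteq> 0"
    and fact: "\<And>z. cmod z \<le> r \<Longrightarrow> \<forall>\<^sub>F w in at z. D w = F w * (\<Prod>a\<in>Z. blaschke r a w powi zorder D a)"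
    using blaschke_factorization[OF analytic_on_imp_meromorphic_on[OF Dr] nz' circ, folded Z_def]
    by blast
  define W where "W w = (\<Prod>a\<in>Z. blaschke r a w powi zorder D a)" for w
  have Zlt: "cmod a < r" if "a \<in> Z" for a
    using that circ[of a] by (auto simp: Z_def order.strict_iff_order)
  have Zpos: "0 \<le> zorder D a" if "a \<in> Z" for a
  proof (rule zorder_ge_0)
    show "D analytic_on {a}" using Dr Zlt[OF that] by (auto intro: analytic_on_subset)
    show "\<exists>\<^sub>F z in at a. D z \<noteq> 0" using nz[of a] Zlt[OF that] r by (auto simp: eventually_frequently)
  qed
  have Wana: "W analytic_on cball 0 r" unfolding W_def by (rule blaschke_power_analytic[OF Zlt Zpos])
  have DFW: "D z = F z * W z" if z: "cmod z \<le> r" for z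
  proof (rule eventually_at_eq_imp_eq[where f = D and g = "\<lambda>z. F z * W z"])
    show "\<forall>\<^sub>F w in at z. D w = F w * W w" using fact[OF z] by (simp add: W_def)
    show "isCont D z" "isCont (\<lambda>z. F z * W z) z"
      using z by (auto intro!: continuous_intros analytic_on_cball_isCont[OF Dr]
          analytic_on_cball_isCont[OF F(1)] analytic_on_cball_isCont[OF Wana])
  qed
  have W1: "cmod (W z) = 1" if "cmod z = r" for z
    unfolding W_def by (rule blaschke_power_norm_eq_1[OF Zlt that])
  have Wle: "cmod (W z) \<le> 1" if "cmod z \<le> r" for z
    unfolding W_def by (rule blaschke_power_norm_le_1[OF Zlt Zpos that])
  have r0: "r > 0" using r R by simp
  obtain L where L: "L holomorphic_on ball 0 r" "continuous_on (cball 0 r) L"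
    and FL: "\<And>z. cmod z \<le> r \<Longrightarrow> F z = exp (L z)"
    using analytic_logarithm_on_cball[OF F r0] by blast
  have wr: "cmod w \<le> r / 2" using w r by simp
  \<comment> \<open>lower bound for the zero-free factor\<close>
  have "Re (of_real M - L w) \<le> 3 * Re (of_real M - L 0)"
  proof (rule harnack_upper[where L = "\<lambda>z. of_real M - L z", OF _ _ r0 wr])
    fix z assume z: "cmod z = r"
    have "exp (Re (L z)) = cmod (D z)" using z by (simp add: DFW FL norm_mult W1)
    also have "\<dots> \<le> exp M" using D[of z] z r by simp
    finally show "0 \<le> Re (of_real M - L z)" by simp
  qed (intro continuous_intros holomorphic_intros L)+
  moreover have "- M \<le> Re (L 0)"
  proof -
    have "exp (- M) \<le> cmod (F 0) * cmod (W 0)" using D0 DFW[of 0] r0 by (simp add: norm_mult)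
    also have "\<dots> \<le> cmod (F 0) * 1" using Wle[of 0] r0 by (intro mult_left_mono) auto
    also have "\<dots> = exp (Re (L 0))" using FL[of 0] r0 by simp
    finally show ?thesis by simp
  qed
  ultimately have Lw: "- 5 * M \<le> Re (L w)" by simp
  have "cmod (h w * F w) \<le> exp M"
  proof (rule maximum_modulus_frontier[of "\<lambda>z. h z * F z" "cball 0 r"])
    have hF: "(\<lambda>z. h z * F z) analytic_on cball 0 r"
      using cb hol(3) by (intro analytic_intros F(1) analytic_on_subset[OF _ cb]) (simp add: analytic_on_open)
    show "(\<lambda>z. h z * F z) holomorphic_on interior (cball 0 r)"
      by (rule analytic_imp_holomorphic[OF analytic_on_subset[OF hF]]) auto
    show "continuous_on (closure (cball 0 r)) (\<lambda>z. h z * F z)"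
      using analytic_imp_holomorphic[OF hF] by (simp add: holomorphic_on_imp_continuous_on)
    fix z assume "z \<in> frontier (cball (0::complex) r)"
    then have z: "cmod z = r" by simp
    have "cmod (h z * F z) = cmod (A z)"
      using z r by (simp add: quot DFW norm_mult W1)
    also have "\<dots> \<le> exp M" using A[of z] z r by simp
    finally show "cmod (h z * F z) \<le> exp M" .
  qed (use wr r0 in auto)
  then have "cmod (h w) * exp (Re (L w)) \<le> exp M" using FL[of w] wr r0 by (simp add: norm_mult)
  then have "cmod (h w) \<le> exp M / exp (Re (L w))" by (simp add: field_simps)
  also have "\<dots> = exp (M - Re (L w))" by (simp add: exp_diff)
  also have "\<dots> \<le> exp (6 * M)" using Lw by simp
  finally show ?thesis .
qed

section \<open>Pole counting from the characteristic function\<close>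

lemma growth_order_imp_char_le_power:
  assumes "growth_order f < \<infinity>"
  obtains K R0 where "R0 \<ge> 1" "\<And>r. r \<ge> R0 \<Longrightarrow> nevanlinna_char f r \<le> r ^ K"
proof -
  obtain C :: real where C: "growth_order f < ereal C"
    using assms by (metis ereal_dense2 ereal_less(3) less_ereal.simps(4) real_of_ereal.elims not_less_iff_gr_or_eq)
  obtain K :: nat where K: "C \<le> real K" using real_arch_simple by blast
  have "\<forall>\<^sub>F r in at_top. ereal (ln_plus (nevanlinna_char f r) / ln r) < ereal C"
    using C unfolding growth_order_def by (rule Limsup_lessD)
  then obtain R1 where R1: "\<And>r. r \<ge> R1 \<Longrightarrow> ln_plus (nevanlinna_char f r) / ln r < C"
    by (auto simp: eventually_at_top_linorder)
  show thesis
  proof (rule that[of "max 2 R1" K])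
    fix r assume r: "max 2 R1 \<le> r"
    then have lnr: "ln r > 0" and r1: "r \<ge> 1" by auto
    have "ln_plus (nevanlinna_char f r) < C * ln r"
      using R1[of r] r lnr by (simp add: pos_divide_less_eq)
    also have "\<dots> \<le> real K * ln r" using K lnr by (intro mult_right_mono) auto
    finally have *: "ln_plus (nevanlinna_char f r) < ln (r ^ K)" using r1 by (simp add: ln_realpow)
    show "nevanlinna_char f r \<le> r ^ K"
    proof (cases "nevanlinna_char f r \<le> 1")
      case True
      then show ?thesis using one_le_power[OF r1, of K] by linarith
    next
      case False
      then have "ln (nevanlinna_char f r) < ln (r ^ K)" using * by (simp add: ln_plus_def)
      then show ?thesis using False r1 by (subst (asm) ln_less_cancel_iff) auto
    qed
  qed simp
qed

lemma has_integral_step_over_t: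
  fixes a r :: real
  assumes "0 < a" "a \<le> r"
  shows "((\<lambda>t. if a \<le> t then 1 / t else 0) has_integral ln (r / a)) {0..r}"
proof -
  have "((\<lambda>t. 1 / t) has_integral ln r - ln a) {a..r}"
    by (rule fundamental_theorem_of_calculus)
       (use assms in \<open>auto simp: divide_inverse has_real_derivative_iff_has_vector_derivative[symmetric]
          intro!: derivative_eq_intros\<close>)
  then have "((\<lambda>t. if t \<in> {a..r} then 1 / t else 0) has_integral ln r - ln a) {0..r}"
    using assms by (subst has_integral_restrict) auto
  then have "((\<lambda>t. if a \<le> t then 1 / t else 0) has_integral ln r - ln a) {0..r}"
    by (rule has_integral_eq[rotated]) auto
  then show ?thesis using assms by (simp add: ln_div)
qed

lemma nicely_meromorphic_imp_meromorphic:
  "f nicely_meromorphic_on UNIV \<Longrightarrow> f meromorphic_on A"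
  using meromorphic_on_subset unfolding nicely_meromorphic_on_def by blast

context
  fixes f :: "complex \<Rightarrow> complex"
  assumes nice: "f nicely_meromorphic_on UNIV" and nz: "\<And>z. \<forall>\<^sub>F w in at z. f w \<noteq> 0"
begin

lemma is_pole_iff_zorder_neg: "is_pole f z \<longleftrightarrow> zorder f z < 0"
proof -
  have "isolated_singularity_at f z" using nicely_meromorphic_imp_meromorphic[OF nice, of UNIV] by (auto simp: meromorphic_on_altdef)
  then show ?thesis
    using isolated_pole_imp_neg_zorder[of f z] zorder_neg_imp_is_pole[OF nicely_meromorphic_imp_meromorphic[OF nice] nz] by blast
qed

lemma finite_poles_in_disc: "finite {z. cmod z \<le> r \<and> is_pole f z}"
proof (rule finite_subset)
  show "finite {a \<in> cball 0 r. zorder f a \<noteq> 0}"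
    by (rule finite_zorder_nonzero[OF nicely_meromorphic_imp_meromorphic[OF nice]]) (use nz in auto)
qed (auto simp: is_pole_iff_zorder_neg)

text \<open>
  The counting function is a finite sum of step functions, and each pole contributes
  \<open>ln (r / \<bar>b\<bar>)\<close> to the integral.
\<close>

lemma integrated_pole_count_eq:
  assumes "r > 0"
  shows "integrated_pole_count f r =
    (\<Sum>b\<in>{z. cmod z \<le> r \<and> is_pole f z} - {0}. real_of_int (- zorder f b) * ln (r / cmod b))
      + pole_count f 0 * ln r"
proof -
  define S where "S = {z. cmod z \<le> r \<and> is_pole f z} - {0}"
  have finS: "finite S" using finite_poles_in_disc[of r] by (simp add: S_def)
  have "((\<lambda>t. \<Sum>b\<in>S. real_of_int (- zorder f b) * (if cmod b \<le> t then 1 / t else 0)) has_integral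
      (\<Sum>b\<in>S. real_of_int (- zorder f b) * ln (r / cmod b))) {0..r}"
    by (intro has_integral_sum finS has_integral_mult_right has_integral_step_over_t)
       (auto simp: S_def)
  moreover have "(\<Sum>b\<in>S. real_of_int (- zorder f b) * (if cmod b \<le> t then 1 / t else 0))
      = (pole_count f t - pole_count f 0) / t" if t: "t \<in> {0..r}" for t
  proof -
    define T where "T = {z. cmod z \<le> t \<and> is_pole f z}"
    define T0 where "T0 = {z. cmod z \<le> 0 \<and> is_pole f z}"
    have fin: "finite T" using finite_poles_in_disc[of t] by (simp add: T_def)
    have sub: "T0 \<subseteq> T" using t by (auto simp: T_def T0_def)
    have "T - T0 = {b \<in> S. cmod b \<le> t}" using t by (auto simp: T_def T0_def S_def)
    then have "pole_count f t - pole_count f 0 = (\<Sum>b\<in>{b \<in> S. cmod b \<le> t}. real_of_int (- zorder f b))"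
      unfolding pole_count_def T_def[symmetric] T0_def[symmetric]
      using sum_diff[OF fin sub, of "\<lambda>b. real_of_int (- zorder f b)"] by simp
    also have "\<dots> = (\<Sum>b\<in>S. if cmod b \<le> t then real_of_int (- zorder f b) else 0)"
      using finS by (rule sum.inter_filter)
    finally show ?thesis
      by (auto simp: sum_divide_distrib intro!: sum.cong)
  qed
  ultimately have "((\<lambda>t. (pole_count f t - pole_count f 0) / t) has_integral
      (\<Sum>b\<in>S. real_of_int (- zorder f b) * ln (r / cmod b))) {0..r}"
    by (rule has_integral_eq[rotated]) auto
  then show ?thesis by (simp add: integrated_pole_count_def integral_unique S_def)
qed

lemma pole_count_0_nonneg: "0 \<le> pole_count f 0"
  unfolding pole_count_def by (intro sum_nonneg) (auto simp: is_pole_iff_zorder_neg)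

lemma integrated_pole_count_nonneg:
  assumes "r \<ge> 1" shows "0 \<le> integrated_pole_count f r"
proof -
  have "r > 0" using assms by simp
  show ?thesis unfolding integrated_pole_count_eq[OF \<open>r > 0\<close>]
    using assms pole_count_0_nonneg
    by (intro add_nonneg_nonneg sum_nonneg mult_nonneg_nonneg) (auto simp: is_pole_iff_zorder_neg)
qed

text \<open>
  Every pole in the disc of radius \<open>r\<close> contributes at least \<open>ln 2 \<ge> 1/2\<close> to the integrated
  count at radius \<open>2r\<close>.
\<close>

lemma pole_count_le_integrated:
  assumes "r \<ge> 1" shows "pole_count f r \<le> 2 * integrated_pole_count f (2 * r)"
proof -
  define S where "S = {z. cmod z \<le> r \<and> is_pole f z} - {0}"
  define S2 where "S2 = {z. cmod z \<le> 2 * r \<and> is_pole f z} - {0}"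
  define \<nu> where "\<nu> b = real_of_int (- zorder f b)" for b
  have pos: "0 \<le> \<nu> b" if "is_pole f b" for b using that by (simp add: \<nu>_def is_pole_iff_zorder_neg)
  have ln2: "ln 2 \<ge> (1/2::real)" using ln2_ge_two_thirds by linarith
  have "pole_count f r = (\<Sum>b\<in>S. \<nu> b) + pole_count f 0"
  proof -
    have "S = {z. cmod z \<le> r \<and> is_pole f z} - {z. cmod z \<le> 0 \<and> is_pole f z}" by (auto simp: S_def)
    then show ?thesis
      unfolding pole_count_def \<nu>_def
      using sum_diff[OF finite_poles_in_disc[of r], of "{z. cmod z \<le> 0 \<and> is_pole f z}" "\<lambda>b. real_of_int (- zorder f b)"] assms
      by (smt (verit, best) Collect_mono_iff)
  qed
  also have "\<dots> \<le> (\<Sum>b\<in>S. \<nu> b * (2 * ln (2 * r / cmod b))) + pole_count f 0 * (2 * ln (2 * r))"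
  proof (rule add_mono)
    show "(\<Sum>b\<in>S. \<nu> b) \<le> (\<Sum>b\<in>S. \<nu> b * (2 * ln (2 * r / cmod b)))"
    proof (rule sum_mono)
      fix b assume b: "b \<in> S"
      have "2 \<le> 2 * r / cmod b" using b by (auto simp: S_def field_simps)
      then have "ln 2 \<le> ln (2 * r / cmod b)" by (subst ln_le_cancel_iff) auto
      then have "\<nu> b * 1 \<le> \<nu> b * (2 * ln (2 * r / cmod b))"
        using b ln2 pos[of b] by (intro mult_left_mono) (auto simp: S_def)
      then show "\<nu> b \<le> \<nu> b * (2 * ln (2 * r / cmod b))" by simp
    qed
    have "ln 2 \<le> ln (2 * r)" using assms by (subst ln_le_cancel_iff) auto
    then have "pole_count f 0 * 1 \<le> pole_count f 0 * (2 * ln (2 * r))"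
      using ln2 pole_count_0_nonneg by (intro mult_left_mono) auto
    then show "pole_count f 0 \<le> pole_count f 0 * (2 * ln (2 * r))" by simp
  qed
  also have "(\<Sum>b\<in>S. \<nu> b * (2 * ln (2 * r / cmod b))) \<le> (\<Sum>b\<in>S2. \<nu> b * (2 * ln (2 * r / cmod b)))"
  proof (rule sum_mono2)
    show "finite S2" using finite_poles_in_disc[of "2 * r"] by (simp add: S2_def)
    show "S \<subseteq> S2" using assms by (auto simp: S_def S2_def)
    fix b assume b: "b \<in> S2 - S"
    then show "0 \<le> \<nu> b * (2 * ln (2 * r / cmod b))"
      using pos[of b] by (intro mult_nonneg_nonneg) (auto simp: S2_def)
  qed
  also have "(\<Sum>b\<in>S2. \<nu> b * (2 * ln (2 * r / cmod b))) + pole_count f 0 * (2 * ln (2 * r))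
      = 2 * integrated_pole_count f (2 * r)"
    using assms by (subst integrated_pole_count_eq) (auto simp: S2_def \<nu>_def sum_distrib_left algebra_simps)
  finally show ?thesis by simp
qed

end

lemma proximity_nonneg: "0 \<le> proximity g r"
proof -
  have "0 \<le> integral {0..2 * pi} (\<lambda>t. ln_plus (cmod (g (complex_of_real r * cis t))))"
  proof (cases "(\<lambda>t. ln_plus (cmod (g (complex_of_real r * cis t)))) integrable_on {0..2 * pi}")
    case True
    then show ?thesis by (rule integral_nonneg) (auto simp: ln_plus_def)
  qed (simp add: not_integrable_integral)
  then show ?thesis by (simp add: proximity_def)
qed

section \<open>Functions of finite order as local quotients\<close>

text \<open>
  Divide out the Blaschke product of the poles in a disc with radius between \<open>2R\<close> and \<open>3R\<close> whose
  boundary carries neither zeros nor poles. The numerator is then bounded through the Poisson integral by the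
  proximity function, and the denominator is bounded below on \<open>S\<close> because the number of its zeros
  grows at most like a power.
\<close>

lemma bounded_quotient_on_disc:
  assumes nice: "f nicely_meromorphic_on UNIV" and nz: "\<And>z. \<forall>\<^sub>F w in at z. f w \<noteq> 0"
    and R0: "R0 \<ge> 1" and char: "\<And>r. r \<ge> R0 \<Longrightarrow> nevanlinna_char f r \<le> r ^ K"
    and \<delta>: "0 < \<delta>" "\<delta> \<le> 1" "\<And>s a. s \<in> S \<Longrightarrow> is_pole f a \<Longrightarrow> \<delta> \<le> cmod (s - a)"
    and R: "R \<ge> R0" "R \<ge> 12 * 6 ^ K / \<delta>"
  obtains F B where "F holomorphic_on ball 0 R" "B holomorphic_on ball 0 R"
    "\<And>z. cmod z < R \<Longrightarrow> cmod (F z) \<le> exp (R ^ (K + 2))"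
    "\<And>z. cmod z < R \<Longrightarrow> cmod (B z) \<le> 1"
    "\<And>z. cmod z < R \<Longrightarrow> \<not> is_pole f z \<Longrightarrow> F z = f z * B z"
    "\<And>s. s \<in> S \<Longrightarrow> cmod s < R \<Longrightarrow> exp (- (R ^ (K + 2))) \<le> cmod (B s)"
proof -
  have R1: "R \<ge> 1" using R R0 by simp
  have "\<exists>\<rho>. 2 * R < \<rho> \<and> \<rho> < 3 * R \<and> (\<forall>z. cmod z = \<rho> \<longrightarrow> zorder f z = 0)"
    by (rule exists_regular_radius[OF nicely_meromorphic_imp_meromorphic[OF nice] nz, of "2 * R" "3 * R"])
       (use R1 in auto)
  then obtain \<rho> where \<rho>: "2 * R < \<rho>" "\<rho> < 3 * R" and circ: "\<And>z. cmod z = \<rho> \<Longrightarrow> zorder f z = 0"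
    by blast
  have \<rho>0: "\<rho> > 0" using \<rho> R1 by simp
  define Z where "Z = {a \<in> cball 0 \<rho>. zorder f a \<noteq> 0}"
  obtain F1 where F1: "F1 analytic_on cball 0 \<rho>" "\<And>z. cmod z \<le> \<rho> \<Longrightarrow> F1 z \<noteq> 0"
    and fact: "\<And>z. cmod z \<le> \<rho> \<Longrightarrow> \<forall>\<^sub>F w in at z. f w = F1 w * (\<Prod>a\<in>Z. blaschke \<rho> a w powi zorder f a)"
    using blaschke_factorization[of f \<rho>, OF nicely_meromorphic_imp_meromorphic[OF nice] nz circ, folded Z_def]
    by blast
  have finZ: "finite Z" unfolding Z_def
    by (rule finite_zorder_nonzero[OF nicely_meromorphic_imp_meromorphic[OF nice]]) (use nz in auto)
  define Zp where "Zp = {a \<in> Z. zorder f a < 0}"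
  define Zm where "Zm = {a \<in> Z. zorder f a > 0}"
  have split: "Z = Zm \<union> Zp" "Zm \<inter> Zp = {}" by (auto simp: Zp_def Zm_def Z_def)
  have fin: "finite Zm" "finite Zp" using finZ by (auto simp: Zp_def Zm_def)
  have Zlt: "cmod a < \<rho>" if "a \<in> Z" for a
    using that circ[of a] by (auto simp: Z_def order.strict_iff_order)
  then have Zmlt: "cmod a < \<rho>" if "a \<in> Zm" for a using that by (auto simp: Zm_def)
  have Zplt: "cmod a < \<rho>" if "a \<in> Zp" for a using that Zlt by (auto simp: Zp_def)
  have Zmpos: "0 \<le> zorder f a" if "a \<in> Zm" for a using that by (auto simp: Zm_def)
  have Zppos: "0 \<le> - zorder f a" if "a \<in> Zp" for a using that by (auto simp: Zp_def)
  define Pm where "Pm w = (\<Prod>a\<in>Zm. blaschke \<rho> a w powi zorder f a)" for w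
  define B where "B w = (\<Prod>a\<in>Zp. blaschke \<rho> a w powi (- zorder f a))" for w
  define F where "F w = F1 w * Pm w" for w
  have Pana: "Pm analytic_on cball 0 \<rho>"
    unfolding Pm_def by (rule blaschke_power_analytic[OF Zmlt Zmpos])
  have Bana: "B analytic_on cball 0 \<rho>"
    unfolding B_def by (rule blaschke_power_analytic[OF Zplt Zppos])
  have Fana: "F analytic_on cball 0 \<rho>" unfolding F_def by (intro analytic_intros F1 Pana)
  have FfB: "F z = f z * B z" if z: "cmod z \<le> \<rho>" and np: "\<not> is_pole f z" for z
  proof (rule eventually_at_eq_imp_eq[where f = F and g = "\<lambda>z. f z * B z"])
    have "\<forall>\<^sub>F w in at z. \<forall>a\<in>Z. blaschke \<rho> a w \<noteq> 0"
      using finZ by (intro eventually_ball_finite) (auto intro: eventually_blaschke_nonzero Zlt)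
    with fact[OF z] show "\<forall>\<^sub>F w in at z. F w = f w * B w"
    proof eventually_elim
      case (elim w)
      have "(\<Prod>a\<in>Zp. blaschke \<rho> a w powi zorder f a) * B w = 1"
        unfolding B_def prod.distrib[symmetric] using elim(2)
        by (intro prod.neutral) (auto simp: power_int_minus Zp_def)
      then have "(\<Prod>a\<in>Z. blaschke \<rho> a w powi zorder f a) * B w = Pm w"
        unfolding split(1) prod.union_disjoint[OF fin split(2)] Pm_def by (simp add: mult.assoc)
      then show ?case by (simp add: elim(1) F_def mult.assoc)
    qed
    have "isCont f z"
      by (intro analytic_at_imp_isCont nicely_meromorphic_on_imp_analytic_at[OF nice _ np]) auto
    then show "isCont F z" "isCont (\<lambda>z. f z * B z) z"
      using z by (auto intro!: continuous_intros analytic_on_cball_isCont[OF Fana] analytic_on_cball_isCont[OF Bana])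
  qed
  have circle: "cmod (f z) = cmod (F1 z)" if z: "cmod z = \<rho>" for z
  proof -
    have "\<not> is_pole f z" using circ[OF z] is_pole_iff_zorder_neg[OF nice nz] by simp
    then have "cmod (F z) = cmod (f z * B z)" using FfB[of z] z by simp
    moreover have "cmod (B z) = 1" unfolding B_def by (rule blaschke_power_norm_eq_1[OF Zplt z])
    moreover have "cmod (Pm z) = 1" unfolding Pm_def by (rule blaschke_power_norm_eq_1[OF Zmlt z])
    ultimately show ?thesis by (simp add: F_def norm_mult)
  qed
  obtain L where L: "L holomorphic_on ball 0 \<rho>" "continuous_on (cball 0 \<rho>) L"
    and FL: "\<And>z. cmod z \<le> \<rho> \<Longrightarrow> F1 z = exp (L z)"
    using analytic_logarithm_on_cball[OF F1 \<rho>0] by blast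
  have "max 0 (Re (L (of_real \<rho> * cis t))) = ln_plus (cmod (f (of_real \<rho> * cis t)))" for t
  proof -
    have "cmod (of_real \<rho> * cis t) = \<rho>" using \<rho>0 by (simp add: norm_mult)
    then have "cmod (f (of_real \<rho> * cis t)) = exp (Re (L (of_real \<rho> * cis t)))"
      using circle FL by simp
    then show ?thesis by (simp add: ln_plus_def)
  qed
  then have prox: "Re (L w) \<le> 3 * proximity f \<rho>" if "cmod w \<le> \<rho> / 2" for w
    using poisson_upper_bound[OF L(2,1) \<rho>0 that] by (simp add: proximity_def)
  have "proximity f \<rho> \<le> nevanlinna_char f \<rho>"
    using integrated_pole_count_nonneg[OF nice nz, of \<rho>] \<rho> R1 by (simp add: nevanlinna_char_def)
  also have "\<dots> \<le> \<rho> ^ K" using \<rho> R R1 by (intro char) simp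
  also have "\<dots> \<le> (3 * R) ^ K" using \<rho> \<rho>0 by (intro power_mono) auto
  finally have "3 * proximity f \<rho> \<le> (3 * 3 ^ K) * R ^ K" by (simp add: power_mult_distrib)
  also have "\<dots> \<le> R * R ^ K"
  proof (rule mult_right_mono)
    have "3 * 3 ^ K \<le> 12 * (6::real) ^ K" by (intro mult_mono power_mono) auto
    also have "\<dots> \<le> 12 * 6 ^ K / \<delta>" using \<delta> by (simp add: field_simps)
    finally show "3 * 3 ^ K \<le> R" using R by linarith
  qed (use R1 in simp)
  also have "\<dots> \<le> R ^ (K + 2)" using R1 power_increasing[of "Suc K" "K + 2" R] by simp
  finally have prox_le: "3 * proximity f \<rho> \<le> R ^ (K + 2)" .
  have Fbound: "cmod (F z) \<le> exp (R ^ (K + 2))" if z: "cmod z < R" for z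
  proof -
    have "cmod (F z) = cmod (F1 z) * cmod (Pm z)" by (simp add: F_def norm_mult)
    also have "\<dots> \<le> cmod (F1 z) * 1"
      unfolding Pm_def by (intro mult_left_mono blaschke_power_norm_le_1[OF Zmlt Zmpos]) (use z \<rho> R1 in auto)
    also have "\<dots> = exp (Re (L z))" using FL[of z] z \<rho> R1 by simp
    also have "\<dots> \<le> exp (R ^ (K + 2))" using prox[of z] prox_le z \<rho> by simp
    finally show ?thesis .
  qed
  have Bbound: "cmod (B z) \<le> 1" if "cmod z < R" for z
    unfolding B_def by (intro blaschke_power_norm_le_1[OF Zplt Zppos]) (use that \<rho> R1 in auto)
  have Blower: "exp (- (R ^ (K + 2))) \<le> cmod (B s)" if s: "s \<in> S" "cmod s < R" for s
  proof -
    define q where "q = \<delta> / (2 * \<rho>)"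
    have q: "q > 0" using \<delta> \<rho>0 by (simp add: q_def)
    define n where "n = (\<Sum>a\<in>Zp. nat (- zorder f a))"
    have poles: "Zp = {z. cmod z \<le> \<rho> \<and> is_pole f z}"
      by (auto simp: Zp_def Z_def is_pole_iff_zorder_neg[OF nice nz])
    have n: "real n = pole_count f \<rho>"
      unfolding n_def pole_count_def poles[symmetric] of_nat_sum
      by (rule sum.cong) (auto simp: Zp_def)
    also have "\<dots> \<le> 2 * integrated_pole_count f (2 * \<rho>)"
      using \<rho> R1 by (intro pole_count_le_integrated[OF nice nz]) auto
    also have "\<dots> \<le> 2 * nevanlinna_char f (2 * \<rho>)"
      using proximity_nonneg[of f "2 * \<rho>"] by (simp add: nevanlinna_char_def)
    also have "\<dots> \<le> 2 * (2 * \<rho>) ^ K" using \<rho> R R1 by (intro mult_left_mono char) auto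
    also have "\<dots> \<le> 2 * (6 * R) ^ K" using \<rho> \<rho>0 by (intro mult_left_mono power_mono) auto
    finally have n_le: "real n \<le> 2 * (6 * R) ^ K" .
    have "- ln q = ln (2 * \<rho> / \<delta>)" using \<delta> \<rho>0 by (simp add: q_def ln_div)
    also have "\<dots> \<le> 2 * \<rho> / \<delta>" using \<delta> \<rho>0 by (intro ln_bound) auto
    also have "\<dots> \<le> 6 * R / \<delta>" using \<delta> \<rho> by (intro divide_right_mono) auto
    finally have lnq: "- ln q \<le> 6 * R / \<delta>" .
    have "real n * (- ln q) \<le> real n * (6 * R / \<delta>)" using lnq by (intro mult_left_mono) auto
    also have "\<dots> \<le> 2 * (6 * R) ^ K * (6 * R / \<delta>)" using n_le \<delta> R1 by (intro mult_right_mono) auto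
    also have "\<dots> = (12 * 6 ^ K / \<delta>) * R ^ Suc K" by (simp add: power_mult_distrib)
    also have "\<dots> \<le> R * R ^ Suc K" using R R1 by (intro mult_right_mono) auto
    finally have le: "- (R ^ (K + 2)) \<le> real n * ln q" by simp
    have "exp (- (R ^ (K + 2))) \<le> exp (real n * ln q)" using le by simp
    also have "\<dots> = q ^ n" using q by (simp add: exp_of_nat_mult)
    also have "\<dots> = (\<Prod>a\<in>Zp. q ^ nat (- zorder f a))" by (simp add: n_def power_sum)
    also have "\<dots> \<le> (\<Prod>a\<in>Zp. cmod (blaschke \<rho> a s) ^ nat (- zorder f a))"
    proof (intro prod_mono conjI power_mono)
      fix a assume a: "a \<in> Zp"
      have "\<delta> \<le> cmod (s - a)" using a \<delta>(3)[OF s(1)] by (auto simp: poles)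
      then have "q \<le> cmod (s - a) / (2 * \<rho>)" using \<rho>0 by (simp add: q_def divide_right_mono)
      also have "\<dots> \<le> cmod (blaschke \<rho> a s)" using s(2) \<rho> R1 by (intro norm_blaschke_ge Zplt a) auto
      finally show "q \<le> cmod (blaschke \<rho> a s)" .
    qed (use q in auto)
    also have "\<dots> = cmod (B s)"
      unfolding B_def prod_norm[symmetric]
      by (rule prod.cong) (auto simp: power_int_def Zp_def norm_power)
    finally show ?thesis .
  qed
  have sub: "ball 0 R \<subseteq> cball (0::complex) \<rho>" using \<rho> R1 by auto
  show thesis
  proof (rule that[of F B])
    show "F holomorphic_on ball 0 R" "B holomorphic_on ball 0 R"
      using analytic_imp_holomorphic[OF analytic_on_subset[OF Fana sub]]
        analytic_imp_holomorphic[OF analytic_on_subset[OF Bana sub]] .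
    show "F z = f z * B z" if "cmod z < R" "\<not> is_pole f z" for z
      using that \<rho> R1 by (intro FfB) auto
  qed (use Fbound Bbound Blower in auto)
qed

lemma eventually_at_shift:
  fixes z c :: complex
  assumes "\<forall>\<^sub>F w in at (z + c). P w"
  shows "\<forall>\<^sub>F w in at z. P (w + c)"
  using assms
proof (rule eventually_compose_filterlim)
  show "filterlim (\<lambda>w. w + c) (at (z + c)) (at z)"
    by (rule filterlim_atI) (auto intro!: tendsto_intros simp: eventually_at_filter)
qed

lemma distance_to_poles:
  assumes mero: "f meromorphic_on UNIV" and np: "\<not> is_pole f s"
  obtains \<delta> where "0 < \<delta>" "\<delta> \<le> 1" "\<And>a. is_pole f a \<Longrightarrow> \<delta> \<le> cmod (s - a)"
proof -
  have "\<forall>\<^sub>F w in at s. \<not> is_pole f w"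
    using mero by (intro eventually_not_pole) (auto simp: meromorphic_on_altdef)
  then obtain d where d: "d > 0" "\<And>w. w \<noteq> s \<Longrightarrow> dist w s < d \<Longrightarrow> \<not> is_pole f w"
    unfolding eventually_at by auto
  have "min d 1 \<le> cmod (s - a)" if "is_pole f a" for a
  proof -
    have "\<not> dist a s < d" using d(2)[of a] that np by blast
    then show ?thesis using norm_minus_commute[of s a] by (auto simp: dist_norm min_le_iff_disj)
  qed
  then show thesis using d(1) by (intro that[of "min d 1"]) auto
qed

text \<open>
  The ratio \<open>(g - e) / (f - e)\<close> is entire and zero-free, hence \<open>exp L\<close>. Writing \<open>f = F / B\<close> on a
  large disc and clearing denominators in \<open>g z = f (z + c) - f z\<close> shows it to be the quotient \<open>A / D\<close> of
  two functions with controlled bounds. This bounds the real part of \<open>L\<close> by a power.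
\<close>

lemma shared_value_ratio_exp_polynomial:
  fixes f g :: "complex \<Rightarrow> complex" and c e :: complex
  assumes nice: "f nicely_meromorphic_on UNIV" and nz: "\<And>z. \<forall>\<^sub>F w in at z. f w \<noteq> 0"
    and R0: "R0 \<ge> 1" and char: "\<And>r. r \<ge> R0 \<Longrightarrow> nevanlinna_char f r \<le> r ^ K"
    and gmero: "g meromorphic_on UNIV"
    and diff: "\<And>z. \<forall>\<^sub>F w in at z. g w = f (w + c) - f w"
    and fe: "\<And>z. \<forall>\<^sub>F w in at z. f w \<noteq> e" and ge: "\<And>z. \<forall>\<^sub>F w in at z. g w \<noteq> e"
    and ord: "\<And>z. zorder (\<lambda>w. g w - e) z = zorder (\<lambda>w. f w - e) z"
  obtains P where "\<And>z. \<forall>\<^sub>F w in at z. g w - e = exp (poly P w) * (f w - e)"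
proof -
  have fmero: "f meromorphic_on UNIV" using nice by (simp add: nicely_meromorphic_on_def)
  define H where "H w = (g w - e) / (f w - e)" for w
  define h where "h = remove_sings H"
  have Hmero: "H meromorphic_on UNIV" unfolding H_def by (intro meromorphic_intros fmero gmero)
  have Hnz: "\<forall>\<^sub>F w in at z. H w \<noteq> 0" for z
    using fe[of z] ge[of z] by eventually_elim (simp add: H_def)
  have fe': "\<exists>\<^sub>F w in at z. f w - e \<noteq> 0" and ge': "\<exists>\<^sub>F w in at z. g w - e \<noteq> 0" for z
    using fe[of z] ge[of z] by (simp_all add: eventually_frequently)
  have Hord: "zorder H z = 0" for z
  proof -
    have "zorder H z = zorder (\<lambda>w. g w - e) z - zorder (\<lambda>w. f w - e) z"
      unfolding H_def
      by (rule zorder_divide)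
         (use fe'[of z] ge'[of z] in \<open>auto intro!: meromorphic_intros meromorphic_on_subset[OF fmero] meromorphic_on_subset[OF gmero]\<close>)
    then show ?thesis by (simp add: ord)
  qed
  have hana: "h analytic_on UNIV" and hnz: "h z \<noteq> 0" for z
    unfolding h_def using remove_sings_analytic_nonzero[OF Hmero Hnz Hord] by auto
  then have hhol: "h holomorphic_on UNIV" by (simp add: analytic_imp_holomorphic)
  have heq: "\<forall>\<^sub>F w in at z. g w - e = h w * (f w - e)" for z
  proof -
    have "isolated_singularity_at H z" using Hmero by (auto simp: meromorphic_on_altdef)
    from eventually_remove_sings_eq_at[OF this] fe[of z] show ?thesis
      by eventually_elim (simp add: h_def H_def)
  qed
  obtain L where L: "L holomorphic_on UNIV" "\<And>z. exp (L z) = h z"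
    using holomorphic_logarithm_exists[of UNIV h 0] hhol hnz by auto
  have np: "\<forall>\<^sub>F w in at z. \<not> is_pole f w" for z
    using fmero by (intro eventually_not_pole) (auto simp: meromorphic_on_altdef)
  have "\<forall>\<^sub>F w in at 0. f w \<noteq> e \<and> \<not> is_pole f w \<and> \<not> is_pole f (w + c)"
    using fe[of 0] np[of 0] eventually_at_shift[OF np[of "0 + c"]] by (simp add: eventually_conj_iff)
  then obtain z0 where z0: "f z0 \<noteq> e" "\<not> is_pole f z0" "\<not> is_pole f (z0 + c)"
    using eventually_happens'[OF at_neq_bot[of "0::complex"]] by blast
  obtain \<delta>1 where \<delta>1: "0 < \<delta>1" "\<delta>1 \<le> 1" "\<And>a. is_pole f a \<Longrightarrow> \<delta>1 \<le> cmod (z0 - a)"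
    using distance_to_poles[OF fmero z0(2)] by blast
  obtain \<delta>2 where \<delta>2: "0 < \<delta>2" "\<delta>2 \<le> 1" "\<And>a. is_pole f a \<Longrightarrow> \<delta>2 \<le> cmod (z0 + c - a)"
    using distance_to_poles[OF fmero z0(3)] by blast
  define \<delta> where "\<delta> = min \<delta>1 \<delta>2"
  have \<delta>: "0 < \<delta>" "\<delta> \<le> 1" "\<And>s a. s \<in> {z0, z0 + c} \<Longrightarrow> is_pole f a \<Longrightarrow> \<delta> \<le> cmod (s - a)"
    using \<delta>1 \<delta>2 by (auto simp: \<delta>_def min_le_iff_disj)
  \<comment> \<open>a margin that keeps all discs centred at \<open>z0\<close> and \<open>z0 + c\<close> inside the large disc\<close>
  define a where "a = cmod z0 + cmod c + 1"
  define E where "E = 2 + cmod e + \<bar>ln (cmod (f z0 - e))\<bar>"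
  have E: "2 + cmod e \<le> exp E"
    using exp_ge_add_one_self[of E] by (simp add: E_def)
  have E0: "exp (- E) \<le> cmod (f z0 - e)"
  proof -
    have "- E \<le> ln (cmod (f z0 - e))"
      using norm_ge_zero[of e] abs_ge_minus_self[of "ln (cmod (f z0 - e))"] unfolding E_def by linarith
    then have "exp (- E) \<le> exp (ln (cmod (f z0 - e)))" by simp
    then show ?thesis using z0(1) by simp
  qed
  have "E \<ge> 0" by (simp add: E_def)
  define R1 where "R1 = max (max R0 a) (12 * 6 ^ K / \<delta>)"
  have bound: "Re (L z) \<le> 6 * (2 * 16 ^ (K + 2) + E) * R ^ (K + 2)"
    if R: "R \<ge> R1" and z: "cmod z \<le> R" for R z
  proof -
    define T where "T = 8 * (R + a)"
    have a1: "a \<ge> 1" by (simp add: a_def)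
    have Ra: "R \<ge> R0" "R \<ge> a" "R \<ge> 12 * 6 ^ K / \<delta>" using R by (auto simp: R1_def)
    have T: "T \<ge> R0" "T \<ge> 12 * 6 ^ K / \<delta>" "T \<le> 16 * R" "T > 0"
      using Ra a1 by (auto simp: T_def)
    have R1: "R \<ge> 1" using Ra a1 by simp
    obtain F B where hol: "F holomorphic_on ball 0 T" "B holomorphic_on ball 0 T"
      and F: "\<And>z. cmod z < T \<Longrightarrow> cmod (F z) \<le> exp (T ^ (K + 2))"
      and B: "\<And>z. cmod z < T \<Longrightarrow> cmod (B z) \<le> 1"
      and FfB: "\<And>z. cmod z < T \<Longrightarrow> \<not> is_pole f z \<Longrightarrow> F z = f z * B z"
      and lower: "\<And>s. s \<in> {z0, z0 + c} \<Longrightarrow> cmod s < T \<Longrightarrow> exp (- (T ^ (K + 2))) \<le> cmod (B s)"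
      using bounded_quotient_on_disc[OF nice nz R0 char \<delta> T(1,2)] by blast
    \<comment> \<open>numerator and denominator of \<open>(g - e) / (f - e)\<close> at \<open>z0 + \<zeta>\<close>, multiplied by both values of \<open>B\<close>\<close>
    define A where "A \<zeta> = F (z0 + \<zeta> + c) * B (z0 + \<zeta>) - F (z0 + \<zeta>) * B (z0 + \<zeta> + c)
        - e * B (z0 + \<zeta>) * B (z0 + \<zeta> + c)" for \<zeta>
    define D where "D \<zeta> = B (z0 + \<zeta> + c) * (F (z0 + \<zeta>) - e * B (z0 + \<zeta>))" for \<zeta>
    define M where "M = 2 * T ^ (K + 2) + E"
    have T2: "cmod z0 + T / 2 + cmod c < T" "cmod z0 + T / 2 < T"
      using Ra(2) norm_ge_zero[of z0] norm_ge_zero[of c] unfolding T_def a_def by argo+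
    have inT1: "cmod (z0 + \<zeta>) < T" if "cmod \<zeta> < T / 2" for \<zeta>
      using norm_triangle_ineq[of z0 \<zeta>] that T2 by linarith
    have inT2: "cmod (z0 + \<zeta> + c) < T" if "cmod \<zeta> < T / 2" for \<zeta>
      using norm_triangle_ineq[of z0 \<zeta>] norm_triangle_ineq[of "z0 + \<zeta>" c] that T2
      by linarith
    note inT = inT1 inT2
    have TK: "T ^ (K + 2) \<ge> 0" using T by simp
    define X where "X = exp (T ^ (K + 2))"
    have X1: "X \<ge> 1" using TK by (simp add: X_def)
    have XM: "(2 + cmod e) * X \<le> exp M"
    proof -
      have "(2 + cmod e) * X \<le> exp E * (X * X)"
        using E X1 by (intro mult_mono) auto
      also have "\<dots> = exp M" unfolding M_def X_def mult_2 exp_add by (simp only: mult_ac)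
      finally show ?thesis .
    qed
    have comp: "(\<lambda>\<zeta>. G (z0 + \<zeta>)) holomorphic_on ball 0 (T / 2)"
      "(\<lambda>\<zeta>. G (z0 + \<zeta> + c)) holomorphic_on ball 0 (T / 2)"
      if "G holomorphic_on ball 0 T" for G
    proof -
      have tr: "(\<lambda>\<zeta>. z0 + \<zeta>) holomorphic_on ball 0 (T / 2)" "(\<lambda>\<zeta>. z0 + \<zeta> + c) holomorphic_on ball 0 (T / 2)"
        by (intro holomorphic_intros)+
      have im: "(\<lambda>\<zeta>. z0 + \<zeta>) ` ball 0 (T / 2) \<subseteq> ball 0 T" "(\<lambda>\<zeta>. z0 + \<zeta> + c) ` ball 0 (T / 2) \<subseteq> ball 0 T"
        unfolding image_subset_iff using inT1 inT2 by simp_all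
      show "(\<lambda>\<zeta>. G (z0 + \<zeta>)) holomorphic_on ball 0 (T / 2)"
        "(\<lambda>\<zeta>. G (z0 + \<zeta> + c)) holomorphic_on ball 0 (T / 2)"
        using holomorphic_on_compose_gen[OF tr(1) that im(1)] holomorphic_on_compose_gen[OF tr(2) that im(2)]
        by (simp_all only: o_def)
    qed
    have "cmod (h (z0 + (z - z0))) \<le> exp (6 * M)"
    proof (rule quotient_bound[where R = "T / 2" and A = A and D = D and h = "\<lambda>\<zeta>. h (z0 + \<zeta>)"])
      show holA: "A holomorphic_on ball 0 (T / 2)" and holD: "D holomorphic_on ball 0 (T / 2)"
        unfolding A_def D_def by (intro holomorphic_intros comp hol)+
      show holh: "(\<lambda>\<zeta>. h (z0 + \<zeta>)) holomorphic_on ball 0 (T / 2)"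
        using holomorphic_on_compose_gen[of "\<lambda>\<zeta>. z0 + \<zeta>" "ball 0 (T / 2)" h UNIV] hhol
        by (simp add: o_def holomorphic_on_add)
      show "T / 2 > 0" using T by simp
      show "cmod (z - z0) \<le> T / 2 / 4"
        using norm_triangle_ineq4[of z z0] z norm_ge_zero[of c] unfolding T_def a_def by argo
      show "A \<zeta> = h (z0 + \<zeta>) * D \<zeta>" if \<zeta>: "cmod \<zeta> < T / 2" for \<zeta>
      proof (rule eventually_at_eq_imp_eq[where f = A and g = "\<lambda>\<zeta>. h (z0 + \<zeta>) * D \<zeta>"])
        have "\<forall>\<^sub>F w in at (\<zeta> + z0). g w - e = h w * (f w - e) \<and> g w = f (w + c) - f w
            \<and> \<not> is_pole f w \<and> \<not> is_pole f (w + c)"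
          using heq diff np eventually_at_shift[OF np] by (simp add: eventually_conj_iff)
        from eventually_at_shift[OF this]
        have "\<forall>\<^sub>F w in at \<zeta>. g (z0 + w) - e = h (z0 + w) * (f (z0 + w) - e)
            \<and> g (z0 + w) = f (z0 + w + c) - f (z0 + w)
            \<and> \<not> is_pole f (z0 + w) \<and> \<not> is_pole f (z0 + w + c)"
          by (simp add: add.commute[of _ z0])
        moreover have "\<forall>\<^sub>F w in at \<zeta>. w \<in> ball 0 (T / 2)"
          using \<zeta> by (intro eventually_at_in_open') auto
        ultimately show "\<forall>\<^sub>F w in at \<zeta>. A w = h (z0 + w) * D w"
        proof eventually_elim
          case (elim w)
          define u where "u = f (z0 + w)"
          define v where "v = f (z0 + w + c)"
          define b where "b = B (z0 + w)"
          define b' where "b' = B (z0 + w + c)"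
          have w: "cmod w < T / 2" using elim(2) by simp
          have F1: "F (z0 + w) = u * b" "F (z0 + w + c) = v * b'"
            using FfB inT1[OF w] inT2[OF w] elim(1) by (auto simp: u_def v_def b_def b'_def)
          have "A w = (v - u - e) * (b * b')"
            unfolding A_def F1 by (simp add: b_def b'_def algebra_simps)
          also have "v - u - e = h (z0 + w) * (u - e)" using elim(1) unfolding u_def v_def by metis
          finally show ?case unfolding D_def F1 by (simp add: b_def b'_def algebra_simps)
        qed
        have "\<zeta> \<in> ball 0 (T / 2)" using \<zeta> by simp
        then show "isCont A \<zeta>" "isCont (\<lambda>\<zeta>. h (z0 + \<zeta>) * D \<zeta>) \<zeta>"
          using holomorphic_on_imp_continuous_on[OF holA]
            holomorphic_on_imp_continuous_on[OF holomorphic_on_mult[OF holh holD]]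
            continuous_on_eq_continuous_at[OF open_ball] by blast+
      qed
      show "cmod (A \<zeta>) \<le> exp M" if \<zeta>: "cmod \<zeta> < T / 2" for \<zeta>
      proof -
        note i = inT1[OF \<zeta>] inT2[OF \<zeta>]
        have "cmod (A \<zeta>) \<le> cmod (F (z0 + \<zeta> + c)) * cmod (B (z0 + \<zeta>)) + cmod (F (z0 + \<zeta>)) * cmod (B (z0 + \<zeta> + c))
            + cmod e * cmod (B (z0 + \<zeta>)) * cmod (B (z0 + \<zeta> + c))"
          unfolding A_def norm_mult[symmetric]
          by (intro order_trans[OF norm_triangle_ineq4] add_mono) auto
        also have "\<dots> \<le> X * 1 + X * 1 + cmod e * 1 * 1"
          using F[OF i(1)] F[OF i(2)] B[OF i(1)] B[OF i(2)] X1
          by (intro add_mono mult_mono) (auto simp: X_def)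
        also have "\<dots> \<le> (2 + cmod e) * X" using mult_left_mono[OF X1, of "cmod e"] by (simp add: algebra_simps)
        finally show ?thesis using XM by linarith
      qed
      show "cmod (D \<zeta>) \<le> exp M" if \<zeta>: "cmod \<zeta> < T / 2" for \<zeta>
      proof -
        note i = inT1[OF \<zeta>] inT2[OF \<zeta>]
        have "cmod (D \<zeta>) \<le> cmod (B (z0 + \<zeta> + c)) * (cmod (F (z0 + \<zeta>)) + cmod e * cmod (B (z0 + \<zeta>)))"
          unfolding D_def norm_mult
          by (intro mult_left_mono order_trans[OF norm_triangle_ineq4]) (auto simp: norm_mult)
        also have "\<dots> \<le> 1 * (X + cmod e * 1)"
          using F[OF i(1)] B[OF i(1)] B[OF i(2)] X1
          by (intro add_mono mult_mono) (auto simp: X_def)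
        also have "\<dots> \<le> (2 + cmod e) * X" using mult_left_mono[OF X1, of "cmod e"] X1 by (simp add: algebra_simps)
        finally show ?thesis using XM by linarith
      qed
      show "exp (- M) \<le> cmod (D 0)"
      proof -
        have i: "cmod z0 < T" "cmod (z0 + c) < T" using inT1[of 0] inT2[of 0] T by auto
        have D0: "D 0 = B (z0 + c) * B z0 * (f z0 - e)"
          using FfB[OF i(1) z0(2)] by (simp add: D_def algebra_simps)
        have "exp (- M) = exp (- (T ^ (K + 2))) * exp (- (T ^ (K + 2))) * exp (- E)"
          by (simp add: M_def flip: exp_add)
        also have "\<dots> \<le> cmod (B (z0 + c)) * cmod (B z0) * cmod (f z0 - e)"
          using lower i E0 by (intro mult_mono) auto
        finally show ?thesis by (simp add: D0 norm_mult)
      qed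
    qed
    then have "exp (Re (L z)) \<le> exp (6 * M)" by (simp flip: L(2))
    then have "Re (L z) \<le> 6 * M" by simp
    also have "M \<le> 2 * (16 * R) ^ (K + 2) + E * 1"
    proof -
      have "T ^ (K + 2) \<le> (16 * R) ^ (K + 2)" using T by (intro power_mono) auto
      then show ?thesis unfolding M_def by linarith
    qed
    also have "\<dots> \<le> 2 * (16 * R) ^ (K + 2) + E * R ^ (K + 2)"
      using one_le_power[OF R1, of "K + 2"] \<open>E \<ge> 0\<close> by (intro add_mono mult_left_mono) auto
    also have "\<dots> = (2 * 16 ^ (K + 2) + E) * R ^ (K + 2)"
      by (simp add: power_mult_distrib algebra_simps)
    finally show ?thesis by (simp only: mult.assoc)
  qed
  obtain P where P: "\<And>z. L z = poly P z"
    using entire_polynomial_if_Re_growth[OF L(1), of R1 "6 * (2 * 16 ^ (K + 2) + E)" "K + 2"] bound by blast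
  show thesis
    by (rule that[of P]) (use heq in \<open>simp add: P[symmetric] L(2)\<close>)
qed

section \<open>Shared values\<close>

lemma zorder_minus_const_at_pole:
  assumes mero: "f meromorphic_on {z}" and pole: "is_pole f z"
  shows "zorder (\<lambda>w. f w - e) z = zorder f z"
proof (cases "e = 0")
  case False
  have iso: "isolated_singularity_at f z" using mero by (simp add: meromorphic_at_iff)
  have neg: "zorder f z < 0" by (rule isolated_pole_imp_neg_zorder[OF iso pole])
  have "zorder (\<lambda>w. e) z = 0" using False by (intro zorder_eq_0I) auto
  moreover have "\<forall>\<^sub>F w in at z. f w \<noteq> 0" using non_zero_neighbour_pole[OF pole] .
  ultimately show ?thesis
    using False neg by (intro zorder_diff1 mero meromorphic_intros) (auto simp: eventually_frequently)
qed simp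

lemma shared_values_imp_equal_zorder:
  assumes nice: "f nicely_meromorphic_on UNIV" "g nicely_meromorphic_on UNIV"
    and share: "share_CM g f e" "share_infinity_CM g f"
  shows "zorder (\<lambda>w. g w - e) z = zorder (\<lambda>w. f w - e) z"
proof (cases "is_pole f z")
  case True
  then have "is_pole g z" "zorder g z = zorder f z"
    using share(2) by (auto simp: share_infinity_CM_def)
  then show ?thesis
    using True nice by (simp add: zorder_minus_const_at_pole nicely_meromorphic_imp_meromorphic)
next
  case False
  then have np: "\<not> is_pole g z" using share(2) by (auto simp: share_infinity_CM_def)
  have iff: "f z = e \<longleftrightarrow> g z = e"
    using share(1) False np by (auto simp: share_CM_def value_points_def)
  show ?thesis
  proof (cases "f z = e")
    case True
    then have "z \<in> value_points g e" using np iff by (simp add: value_points_def)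
    then show ?thesis using share(1) by (auto simp: share_CM_def)
  next
    case ne: False
    have "f analytic_on {z}" "g analytic_on {z}"
      using nicely_meromorphic_on_imp_analytic_at[OF nice(1) _ False]
        nicely_meromorphic_on_imp_analytic_at[OF nice(2) _ np] by auto
    then have "zorder (\<lambda>w. f w - e) z = 0" "zorder (\<lambda>w. g w - e) z = 0"
      using ne iff by (auto intro!: zorder_eq_0I analytic_intros)
    then show ?thesis by simp
  qed
qed

lemma nicely_meromorphic_eqI:
  assumes nice: "f nicely_meromorphic_on UNIV" "g nicely_meromorphic_on UNIV"
    and ev: "\<And>z. \<forall>\<^sub>F w in at z. f w = g w"
  shows "f = g"
proof
  fix z
  have rs: "remove_sings k z = k z" if "k nicely_meromorphic_on UNIV" for k
  proof (cases "is_pole k z")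
    case True
    then show ?thesis using is_pole_zero_at_nicely_mero[OF that True] by simp
  next
    case False
    then show ?thesis using nicely_meromorphic_on_imp_analytic_at[OF that _ False] by simp
  qed
  have "remove_sings f z = remove_sings g z" using ev by (rule remove_sings_cong) simp
  then show "f z = g z" using rs nice by simp
qed

lemma nicely_meromorphic_shift:
  assumes "f nicely_meromorphic_on UNIV"
  shows "(\<lambda>z. f (z + c)) nicely_meromorphic_on UNIV"
  unfolding nicely_meromorphic_on_def
proof (intro conjI ballI)
  show "(\<lambda>z. f (z + c)) meromorphic_on UNIV"
    using nicely_meromorphic_imp_meromorphic[OF assms, of UNIV]
    by (rule meromorphic_on_compose) (auto intro!: analytic_intros)
  fix z
  have "(is_pole f (z + c) \<and> f (z + c) = 0) \<or> f \<midarrow>z + c\<rightarrow> f (z + c)"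
    using assms by (auto simp: nicely_meromorphic_on_def)
  moreover have "filterlim (\<lambda>w. w + c) (at (z + c)) (at z)"
    by (rule filterlim_atI) (auto intro!: tendsto_intros simp: eventually_at_filter)
  ultimately show "(is_pole (\<lambda>z. f (z + c)) z \<and> f (z + c) = 0) \<or> (\<lambda>z. f (z + c)) \<midarrow>z\<rightarrow> f (z + c)"
    unfolding is_pole_def using filterlim_compose by blast
qed

text \<open>
  With \<open>u = f z\<close>, \<open>v = f (z + c)\<close> and the exponentials \<open>X\<close>, \<open>Y\<close> at \<open>z\<close>, \<open>X'\<close>, \<open>Y'\<close> at \<open>z + c\<close>: solve the
  sharing conditions at both points for \<open>u\<close> and \<open>v\<close>, and insert the results into
  \<open>v = u (1 + X) + e1 (1 - X)\<close>.
\<close>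

lemma shared_exponentials_relation:
  fixes u v X Y X' Y' e1 e2 :: complex
  assumes "v - u - e1 = X * (u - e1)" "v - u - e2 = Y * (u - e2)"
    and "e1 + X' * (v - e1) = e2 + Y' * (v - e2)"
  shows "(e2 - e1) * X - (e2 - e1) * Y - (e2 - e1) * X' + (e2 - e1) * Y'
      + e1 * X * Y' - e1 * Y * Y' - e2 * X * X' + e2 * X' * Y
      + (e2 - e1) * X * X' * Y - (e2 - e1) * X * Y * Y' = 0"
proof -
  have u: "u * (X - Y) = e2 - e1 + e1 * X - e2 * Y" and v': "v * (X' - Y') = e2 - e1 + e1 * X' - e2 * Y'"
    using assms by algebra+
  have v: "v = u * (1 + X) + e1 * (1 - X)" using assms(1) by algebra
  have "v * (X - Y) = (u * (X - Y)) * (1 + X) + e1 * (1 - X) * (X - Y)"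
    unfolding v by (simp add: algebra_simps)
  then have "v * (X - Y) = (e2 - e1 + e1 * X - e2 * Y) * (1 + X) + e1 * (1 - X) * (X - Y)"
    unfolding u .
  then have "(v * (X' - Y')) * (X - Y)
      = ((e2 - e1 + e1 * X - e2 * Y) * (1 + X) + e1 * (1 - X) * (X - Y)) * (X' - Y')"
    by (simp add: mult.commute mult.left_commute)
  then show ?thesis unfolding v' by (simp add: algebra_simps)
qed

theorem mainTheorem1:
  fixes f :: "complex \<Rightarrow> complex" and c e1 e2 :: complex
  assumes "transcendental_meromorphic f"
    and "growth_order f < \<infinity>"
    and "fdiff c f \<noteq> (\<lambda>_. 0)"
    and "e1 \<noteq> e2"
    and "share_CM (fdiff c f) f e1"
    and "share_CM (fdiff c f) f e2"
    and "share_infinity_CM (fdiff c f) f"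
  shows "f = fdiff c f \<and> (\<forall>z. f (z + c) = 2 * f z)"
proof -
  define g where "g = fdiff c f"
  have nice: "f nicely_meromorphic_on UNIV" and nonrat: "\<not> rational_fun f"
    using assms(1) by (auto simp: transcendental_meromorphic_def)
  have shift_nice: "(\<lambda>z. f (z + c)) nicely_meromorphic_on UNIV"
    by (rule nicely_meromorphic_shift[OF nice])
  have dmero: "(\<lambda>z. f (z + c) - f z) meromorphic_on UNIV"
    by (intro meromorphic_intros nicely_meromorphic_imp_meromorphic nice shift_nice)
  have gnice: "g nicely_meromorphic_on UNIV"
    unfolding g_def fdiff_def by (rule remove_sings_nicely_meromorphic[OF dmero])
  have diff: "\<forall>\<^sub>F w in at z. g w = f (w + c) - f w" for z
    unfolding g_def fdiff_def
    by (rule eventually_remove_sings_eq_at) (use dmero in \<open>auto simp: meromorphic_on_altdef\<close>)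
  have not_const: "\<not> (\<forall>z. f z = a)" for a
  proof
    assume "\<forall>z. f z = a"
    then have "(1 :: complex poly) \<noteq> 0 \<and> (\<forall>z. poly 1 z \<noteq> 0 \<longrightarrow> f z = poly [:a:] z / poly 1 z)" by simp
    then show False using nonrat unfolding rational_fun_def by blast
  qed
  have fne: "\<forall>\<^sub>F w in at z. f w \<noteq> a" for a z
    using nicely_meromorphic_imp_constant_or_avoid[OF nice open_UNIV connected_UNIV, of a] not_const[of a]
      eventually_cosparse_imp_eventually_at[of "\<lambda>w. f w \<noteq> a" UNIV z UNIV] by auto
  have gne: "\<forall>\<^sub>F w in at z. g w \<noteq> e" if share: "share_CM g f e" for e z
  proof -
    have "\<not> (\<forall>z. g z = e)"
    proof
      assume "\<forall>z. g z = e"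
      then have "g = (\<lambda>_. e)" by blast
      then have "value_points g e = UNIV" by (auto simp: value_points_def)
      then have "value_points f e = UNIV" using share by (simp add: share_CM_def)
      then show False using not_const[of e] by (auto simp: value_points_def)
    qed
    then show ?thesis
      using nicely_meromorphic_imp_constant_or_avoid[OF gnice open_UNIV connected_UNIV, of e]
        eventually_cosparse_imp_eventually_at[of "\<lambda>w. g w \<noteq> e" UNIV z UNIV] by auto
  qed
  have share: "share_CM g f e1" "share_CM g f e2" "share_infinity_CM g f"
    using assms by (simp_all add: g_def)
  obtain K R0 where R0: "R0 \<ge> 1" and char: "\<And>r. r \<ge> R0 \<Longrightarrow> nevanlinna_char f r \<le> r ^ K"
    using growth_order_imp_char_le_power[OF assms(2)] by blast
  note ratio = shared_value_ratio_exp_polynomial[OF nice fne R0 char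
      nicely_meromorphic_imp_meromorphic[OF gnice] diff fne gne shared_values_imp_equal_zorder[OF nice gnice]]
  obtain P where P: "\<And>z. \<forall>\<^sub>F w in at z. g w - e1 = exp (poly P w) * (f w - e1)"
    using ratio[OF _ share(1) share(1) share(3)] by blast
  obtain Q where Q: "\<And>z. \<forall>\<^sub>F w in at z. g w - e2 = exp (poly Q w) * (f w - e2)"
    using ratio[OF _ share(2) share(2) share(3)] by blast
  have "\<forall>\<^sub>F w in at z. f w = g w" for z
  proof -
    consider "\<forall>w. exp (poly P w) = 1" | "\<forall>w. exp (poly Q w) = 1" | "\<forall>w. exp (poly P w) = exp (poly Q w)"
      | z0 z1 z2 where "exp (poly P z0) \<noteq> exp (poly Q z0)" "exp (poly P z1) \<noteq> 1" "exp (poly Q z2) \<noteq> 1"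
      by blast
    then show ?thesis
    proof cases
      case 1
      from P[of z] show ?thesis by eventually_elim (simp add: 1)
    next
      case 2
      from Q[of z] show ?thesis by eventually_elim (simp add: 2)
    next
      case 3
      from P[of z] Q[of z] show ?thesis
      proof eventually_elim
        case (elim w)
        have "g w - e2 = exp (poly P w) * (f w - e2)" using elim(2) 3 by simp
        with elim(1) have "(e2 - e1) * (exp (poly P w) - 1) = 0" by algebra
        then have "exp (poly P w) = 1" using \<open>e1 \<noteq> e2\<close> by simp
        then show ?case using elim(1) by simp
      qed
    next
      case 4
      have False
      proof (cases "degree P > 0 \<or> degree Q > 0")
        case False
        then obtain p q where pq: "P = [:p:]" "Q = [:q:]" by (metis degree_eq_zeroE neq0_conv)
        define x y where "x = exp p" and "y = exp q"
        have xy: "x \<noteq> y" using 4(1) by (simp add: pq x_def y_def)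
        have "\<forall>\<^sub>F w in at (0::complex). False"
          \<comment> \<open>both exponentials are constant, so \<open>f\<close> would take this value on an open set\<close>
          using P[of 0] Q[of 0] fne[of "(e2 - e1 + x * e1 - y * e2) / (x - y)" 0]
        proof eventually_elim
          case (elim w)
          have "g w - e1 = x * (f w - e1)" "g w - e2 = y * (f w - e2)"
            using elim by (simp_all add: pq x_def y_def)
          then have "f w * (x - y) = e2 - e1 + x * e1 - y * e2" by algebra
          then show ?case using elim(3) xy by (simp add: field_simps)
        qed
        then show False by simp
      next
        case True
        define P' where "P' = pcompose P [:c, 1:]"
        define Q' where "Q' = pcompose Q [:c, 1:]"
        have P': "exp (poly P' w) = exp (poly P (w + c))" and Q': "exp (poly Q' w) = exp (poly Q (w + c))" for w
          by (simp_all add: P'_def Q'_def poly_pcompose add.commute)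
        define S where "S z = (e2 - e1) * exp (poly P z) - (e2 - e1) * exp (poly Q z)
          - (e2 - e1) * exp (poly P' z) + (e2 - e1) * exp (poly Q' z)
          + e1 * exp (poly P z) * exp (poly Q' z) - e1 * exp (poly Q z) * exp (poly Q' z)
          - e2 * exp (poly P z) * exp (poly P' z) + e2 * exp (poly P' z) * exp (poly Q z)
          + (e2 - e1) * exp (poly P z) * exp (poly P' z) * exp (poly Q z)
          - (e2 - e1) * exp (poly P z) * exp (poly Q z) * exp (poly Q' z)" for z
        have S0: "S z = 0" for z
        proof (rule eventually_at_eq_imp_eq[where f = S and g = "\<lambda>_. 0"])
          show "isCont S z" unfolding S_def by (intro continuous_intros)
          have "\<forall>\<^sub>F w in at z. g (w + c) - e1 = exp (poly P (w + c)) * (f (w + c) - e1)"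
            "\<forall>\<^sub>F w in at z. g (w + c) - e2 = exp (poly Q (w + c)) * (f (w + c) - e2)"
            by (rule eventually_at_shift, rule P, rule eventually_at_shift, rule Q)
          with P[of z] Q[of z] diff[of z] show "\<forall>\<^sub>F w in at z. S w = 0"
          proof eventually_elim
            case (elim w)
            show ?case unfolding S_def
            proof (rule shared_exponentials_relation)
              show "f (w + c) - f w - e1 = exp (poly P w) * (f w - e1)"
                "f (w + c) - f w - e2 = exp (poly Q w) * (f w - e2)"
                using elim(1-3) by metis+
              show "e1 + exp (poly P' w) * (f (w + c) - e1) = e2 + exp (poly Q' w) * (f (w + c) - e2)"
                unfolding P' Q' elim(4,5)[symmetric] by simp
            qed
          qed
        qed simp
        show False
          by (rule shifted_exponentials_no_relation[OF \<open>e1 \<noteq> e2\<close> True 4 S0[unfolded S_def P'_def Q'_def]])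
      qed
      then show ?thesis ..
    qed
  qed
  then have fg: "f = g" by (rule nicely_meromorphic_eqI[OF nice gnice])
  have "(\<lambda>z. f (z + c)) = (\<lambda>z. 2 * f z)"
  proof (rule nicely_meromorphic_eqI[OF shift_nice])
    show "(\<lambda>z. 2 * f z) nicely_meromorphic_on UNIV" by (intro nicely_meromorphic_on_cmult_left nice)
    show "\<forall>\<^sub>F w in at z. f (w + c) = 2 * f w" for z
      using diff[of z] by eventually_elim (simp add: fg[symmetric])
  qed
  then have "\<forall>z. f (z + c) = 2 * f z" by (simp add: fun_eq_iff)
  with fg show ?thesis unfolding g_def by (intro conjI)
qed

end
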